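(* For any nonpure simplicial complex $\Delta$, we have \[ h_{i,j}(\Delta)=\bigl|\{(i,j)\text{-intervals in an }h\text{-compatible partitioning of }\Gamma\}\bigr|-\bigl|\{(i,j)\text{-intervals in an }h\text{-compatible partitioning of }(\Gamma,\Delta)\}\bigr|, \] where $\Gamma\supseteq\Delta$ is the partition extender of $\Delta$ constructed explicitly as described in the context (by attaching to each face $\sigma$ of $\Delta$ the specific complex $E(d_\Delta(\sigma),\dim\sigma)$).
   Context: A simplicial complex is a collection $\Delta$ of subsets of a finite ground set, closed under taking subsets. Its elements are faces, its maximal faces are facets, $\dim\sigma=|\sigma|-1$, $\dim\Delta$ is the maximal dimension of a face, and $\Delta$ is pure if all its facets have the same dimension (nonpure otherwise). For a subcomplex $\Delta$ of $\Gamma$, the relative complex $(\Gamma,\Delta)$ is the set of faces of $\Gamma$ not in $\Delta$; its facets are its maximal elements. The face poset of a (relative) complex is its set of faces ordered by inclusion. A Boolean interval in a poset is an interval $[\sigma,\tau]$ isomorphic to the poset of all subsets of a finite set. A partitioning of a (relative) complex is a decomposition of its face poset into disjoint Boolean intervals, the maximum of each of which is a facet. For a (relative) complex $X$ and $\sigma\in X$, let $d_X(\sigma)=\max\{\dim\tau:\tau\in X,\ \sigma\subseteq\tau\}$. The $f$-triangle and $h$-triangle of $X$ have entries \[ f_{i,j}(X)=|\{\sigma\in X:d_X(\sigma)=i-1,\ \dim\sigma=j-1\}|,\qquad h_{i,j}(X)=\sum_{k=0}^{j}(-1)^{j-k}\binom{i-k}{j-k}f_{i,k}(X). \] An $(i,j)$-interval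 of $X$ is a Boolean interval of its face poset whose bottom element has size $j$ and whose top element is a facet of size $i$. A partitioning of $X$ is $h$-compatible if, for all $i,j$, exactly $h_{i,j}(X)$ of its intervals are $(i,j)$-intervals. Construction of $\Gamma$. Let $-1\le k\le m$. (a) The complex $P(m,k)$ has vertex set $\{1,\dots,2m-k+1\}$. Put $\sigma_0=\{2m-2k+1,\dots,2m-k+1\}$ (so $\dim\sigma_0=k$), $D_1=\{1,\dots,m-k\}\cup\sigma_0$ and $D_2=\{m-k+1,\dots,2m-2k\}\cup\sigma_0$. The facets of $P(m,k)$ are $D_1$, $D_2$, and all sets $\{a+1,\dots,a+m-k+1\}\cup(\sigma_0\setminus\{b\})$ with $0\le a\le m-k-1$ and $b\in\sigma_0$. Its specified facet is $D_2$ and its specified face is $\sigma_0$. (For $k=m$ it is a single $m$-simplex, with $D_1=D_2=\sigma_0$.) (b) The complex $E(m,k)$, with a specified facet and a specified $k$-face contained in it, is defined by decreasing induction on $k$. $E(m,m)=P(m,m)$. For $k<m$, $E(m,k)$ is obtained from $P(m,k)$ by attaching, for every face $\tau$ with $\sigma_0\subsetneq\tau\subseteq D_1$, a copy of $E(m,\dim\tau)$, identifying its specified facet with $D_1$ and its specified face with $\tau$. The specified facet and face of $E(m,k)$ are $D_2$ and $\sigma_0$. (c) $\Gamma$ is obtained from $\Delta$ by attaching, for every face $\sigma$ of $\Delta$ (of every dimension $k$, including the empty face with $k=-1$), a copy of $E(d_\Delta(\sigma),k)$, identifying its specified facet with a facet of $\Delta$ of dimension $d_\Delta(\sigma)$ containing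 $\sigma$, and its specified face with $\sigma$. In all attachments, vertices outside the identified facet are new, and different attached copies share no new vertices. It is known that $\dim\Gamma=\dim\Delta$ and that both $\Gamma$ and $(\Gamma,\Delta)$ have $h$-compatible partitionings. *)

theory Defs
  imports "HOL-Library.Disjoint_Sets"
begin

section \<open>Simplicial and relative complexes\<close>

definition simplicial_complex :: "'a set set \<Rightarrow> bool" where
  "simplicial_complex X \<longleftrightarrow> finite (\<Union>X) \<and> (\<forall>\<sigma>\<in>X. \<forall>\<tau>. \<tau> \<subseteq> \<sigma> \<longrightarrow> \<tau> \<in> X)"

text \<open>A relative complex is represented by its set of faces, so the notions below apply to
  complexes and to relative complexes alike.\<close>

definition relative_complex :: "'a set set \<Rightarrow> 'a set set \<Rightarrow> 'a set set" where
  "relative_complex \<Gamma> \<Delta> = {\<sigma> \<in> \<Gamma>. \<sigma> \<notin> \<Delta>}"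

definition facet :: "'a set set \<Rightarrow> 'a set \<Rightarrow> bool" where
  "facet X \<tau> \<longleftrightarrow> \<tau> \<in> X \<and> (\<forall>\<rho>\<in>X. \<tau> \<subseteq> \<rho> \<longrightarrow> \<rho> = \<tau>)"

definition face_dim :: "'a set \<Rightarrow> int" where
  "face_dim \<sigma> = int (card \<sigma>) - 1"

definition pure_complex :: "'a set set \<Rightarrow> bool" where
  "pure_complex X \<longleftrightarrow> (\<forall>\<sigma> \<tau>. facet X \<sigma> \<and> facet X \<tau> \<longrightarrow> face_dim \<sigma> = face_dim \<tau>)"


section \<open>The f-triangle and the h-triangle\<close>

definition degree_dim :: "'a set set \<Rightarrow> 'a set \<Rightarrow> int" where
  "degree_dim X \<sigma> = Max {face_dim \<tau> |\<tau>. \<tau> \<in> X \<and> \<sigma> \<subseteq> \<tau>}"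

definition f_triangle :: "'a set set \<Rightarrow> nat \<Rightarrow> nat \<Rightarrow> nat" where
  "f_triangle X i j =
     card {\<sigma> \<in> X. degree_dim X \<sigma> = int i - 1 \<and> face_dim \<sigma> = int j - 1}"

text \<open>The truncated subtraction \<open>i - k\<close> is harmless: for \<open>k > i\<close> the factor
  \<open>f_triangle X i k\<close> vanishes.\<close>

definition h_triangle :: "'a set set \<Rightarrow> nat \<Rightarrow> nat \<Rightarrow> int" where
  "h_triangle X i j =
     (\<Sum>k = 0..j. (-1) ^ (j - k) * int ((i - k) choose (j - k)) * int (f_triangle X i k))"


section \<open>Partitionings\<close>

definition face_interval :: "'a set set \<Rightarrow> 'a set \<Rightarrow> 'a set \<Rightarrow> 'a set set" where
  "face_interval X \<sigma> \<tau> = {\<rho> \<in> X. \<sigma> \<subseteq> \<rho> \<and> \<rho> \<subseteq> \<tau>}"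

definition boolean_interval :: "'a set set \<Rightarrow> 'a set \<Rightarrow> 'a set \<Rightarrow> bool" where
  "boolean_interval X \<sigma> \<tau> \<longleftrightarrow> \<sigma> \<in> X \<and> \<tau> \<in> X \<and> \<sigma> \<subseteq> \<tau> \<and>
     (\<exists>(S :: nat set) \<phi>. finite S \<and> bij_betw \<phi> (face_interval X \<sigma> \<tau>) (Pow S) \<and>
        (\<forall>\<alpha> \<in> face_interval X \<sigma> \<tau>. \<forall>\<beta> \<in> face_interval X \<sigma> \<tau>. \<alpha> \<subseteq> \<beta> \<longleftrightarrow> \<phi> \<alpha> \<subseteq> \<phi> \<beta>))"

definition partitioning :: "'a set set \<Rightarrow> 'a set set set \<Rightarrow> bool" where
  "partitioning X \<P> \<longleftrightarrow> partition_on X \<P> \<and>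
     (\<forall>I\<in>\<P>. \<exists>\<sigma> \<tau>. boolean_interval X \<sigma> \<tau> \<and> facet X \<tau> \<and> I = face_interval X \<sigma> \<tau>)"

definition ij_interval :: "'a set set \<Rightarrow> nat \<Rightarrow> nat \<Rightarrow> 'a set set \<Rightarrow> bool" where
  "ij_interval X i j I \<longleftrightarrow>
     (\<exists>\<sigma> \<tau>. boolean_interval X \<sigma> \<tau> \<and> facet X \<tau> \<and> I = face_interval X \<sigma> \<tau> \<and>
        card \<sigma> = j \<and> card \<tau> = i)"

definition h_compatible_partitioning :: "'a set set \<Rightarrow> 'a set set set \<Rightarrow> bool" where
  "h_compatible_partitioning X \<P> \<longleftrightarrow> partitioning X \<P> \<and>
     (\<forall>i j. int (card {I \<in> \<P>. ij_interval X i j I}) = h_triangle X i j)"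


section \<open>The complexes P(m,k)\<close>

text \<open>The parameters are integers, since \<open>k = -1\<close> is allowed.\<close>

definition P_vertices :: "int \<Rightarrow> int \<Rightarrow> int set" where
  "P_vertices m k = {1..2*m - k + 1}"

definition P_face :: "int \<Rightarrow> int \<Rightarrow> int set" where
  "P_face m k = {2*m - 2*k + 1..2*m - k + 1}"

definition P_D1 :: "int \<Rightarrow> int \<Rightarrow> int set" where
  "P_D1 m k = {1..m - k} \<union> P_face m k"

definition P_D2 :: "int \<Rightarrow> int \<Rightarrow> int set" where
  "P_D2 m k = {m - k + 1..2*m - 2*k} \<union> P_face m k"

definition P_facets :: "int \<Rightarrow> int \<Rightarrow> int set set" where
  "P_facets m k = {P_D1 m k, P_D2 m k} \<union>
     {{a + 1..a + m - k + 1} \<union> (P_face m k - {b}) |a b.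
        0 \<le> a \<and> a \<le> m - k - 1 \<and> b \<in> P_face m k}"

definition P_complex :: "int \<Rightarrow> int \<Rightarrow> int set set" where
  "P_complex m k = {\<sigma>. \<exists>F \<in> P_facets m k. \<sigma> \<subseteq> F}"


section \<open>Attaching, the complexes E(m,k), and the partition extender\<close>

text \<open>\<open>attaching B I F K G\<close>: the complex \<open>G\<close> arises from \<open>B\<close> by attaching, for each
  \<open>i \<in> I\<close>, the complex \<open>K i\<close> along \<open>F i\<close>. The \<open>K i\<close> are taken after identification, so that
  \<open>F i\<close> is literally the face shared with \<open>B\<close>, all other vertices of \<open>K i\<close> are new, and
  distinct attached complexes share no new vertices.\<close>

definition attaching ::
  "'a set set \<Rightarrow> 'i set \<Rightarrow> ('i \<Rightarrow> 'a set) \<Rightarrow> ('i \<Rightarrow> 'a set set) \<Rightarrow> 'a set set \<Rightarrow> bool" where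
  "attaching B I F K G \<longleftrightarrow>
     (\<forall>i\<in>I. \<Union>(K i) \<inter> \<Union>B = F i) \<and>
     (\<forall>i\<in>I. \<forall>j\<in>I. i \<noteq> j \<longrightarrow> \<Union>(K i) \<inter> \<Union>(K j) \<subseteq> \<Union>B) \<and>
     G = B \<union> (\<Union>i\<in>I. K i)"

text \<open>\<open>E_copy m k K D \<sigma>\<close>: the complex \<open>K\<close>, with specified facet \<open>D\<close> and specified face \<open>\<sigma>\<close>,
  is a copy of \<open>E(m,k)\<close> on vertices of type \<open>'a\<close>. The map \<open>g\<close> relabels the vertices of
  \<open>P(m,k)\<close>. An identification of a specified facet with another facet that matches the
  specified faces is in general not unique; every choice is admitted.\<close>

inductive E_copy :: "int \<Rightarrow> int \<Rightarrow> 'a set set \<Rightarrow> 'a set \<Rightarrow> 'a set \<Rightarrow> bool" where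
  E_base: "\<lbrakk>-1 \<le> m; inj_on g (P_vertices m m)\<rbrakk>
     \<Longrightarrow> E_copy m m ((\<lambda>\<rho>. g ` \<rho>) ` P_complex m m) (g ` P_D2 m m) (g ` P_face m m)"
| E_step: "\<lbrakk>-1 \<le> k; k < m; inj_on g (P_vertices m k);
     \<And>\<tau>. \<lbrakk>g ` P_face m k \<subset> \<tau>; \<tau> \<subseteq> g ` P_D1 m k\<rbrakk>
        \<Longrightarrow> E_copy m (face_dim \<tau>) (K \<tau>) (g ` P_D1 m k) \<tau>;
     attaching ((\<lambda>\<rho>. g ` \<rho>) ` P_complex m k)
       {\<tau>. g ` P_face m k \<subset> \<tau> \<and> \<tau> \<subseteq> g ` P_D1 m k} (\<lambda>_. g ` P_D1 m k) K G\<rbrakk>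
     \<Longrightarrow> E_copy m k G (g ` P_D2 m k) (g ` P_face m k)"

text \<open>\<open>partition_extender \<Delta> \<Gamma>\<close>: the complex \<open>\<Gamma>\<close> arises from \<open>\<Delta>\<close> by attaching a copy \<open>K \<sigma>\<close> of
  \<open>E(d(\<sigma>), dim \<sigma>)\<close> for every face \<open>\<sigma>\<close>, along an arbitrarily chosen facet \<open>F \<sigma>\<close> of dimension
  \<open>d(\<sigma>)\<close> containing \<open>\<sigma>\<close>. The new vertices are taken from the type \<open>'a\<close> itself.\<close>

definition partition_extender :: "'a set set \<Rightarrow> 'a set set \<Rightarrow> bool" where
  "partition_extender \<Delta> \<Gamma> \<longleftrightarrow>
     (\<exists>F K. (\<forall>\<sigma>\<in>\<Delta>. facet \<Delta> (F \<sigma>) \<and> face_dim (F \<sigma>) = degree_dim \<Delta> \<sigma> \<and> \<sigma> \<subseteq> F \<sigma> \<and>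
                 E_copy (degree_dim \<Delta> \<sigma>) (face_dim \<sigma>) (K \<sigma>) (F \<sigma>) \<sigma>) \<and>
            attaching \<Delta> \<Delta> F K \<Gamma>)"


section \<open>Every complex on an infinite vertex type has a partition extender\<close>

lemma attaching_Union:
  "attaching B I F K G \<Longrightarrow> \<Union>G = \<Union>B \<union> (\<Union>i\<in>I. \<Union>(K i))"
  by (auto simp: attaching_def)

lemma attaching_exists:
  fixes Q :: "'i \<Rightarrow> 'a set set \<Rightarrow> bool"
  assumes "finite I" "finite (\<Union>B)" "\<And>i. i \<in> I \<Longrightarrow> F i \<subseteq> \<Union>B"
    and ex: "\<And>i A. i \<in> I \<Longrightarrow> finite A \<Longrightarrow>
      \<exists>K. Q i K \<and> finite (\<Union>K) \<and> F i \<in> K \<and> \<Union>K \<inter> A \<subseteq> F i"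
  shows "\<exists>K G. attaching B I F K G \<and> (\<forall>i\<in>I. Q i (K i)) \<and> finite (\<Union>G)"
proof -
  have "\<exists>K. (\<forall>i\<in>I. \<Union>(K i) \<inter> \<Union>B = F i) \<and>
      (\<forall>i\<in>I. \<forall>j\<in>I. i \<noteq> j \<longrightarrow> \<Union>(K i) \<inter> \<Union>(K j) \<subseteq> \<Union>B) \<and>
      (\<forall>i\<in>I. Q i (K i) \<and> finite (\<Union>(K i)))"
    using assms(1,3,4)
  proof (induction I rule: finite_induct)
    case empty
    then show ?case by auto
  next
    case (insert x I)
    then obtain K where K: "\<forall>i\<in>I. \<Union>(K i) \<inter> \<Union>B = F i"
      "\<forall>i\<in>I. \<forall>j\<in>I. i \<noteq> j \<longrightarrow> \<Union>(K i) \<inter> \<Union>(K j) \<subseteq> \<Union>B"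
      "\<forall>i\<in>I. Q i (K i) \<and> finite (\<Union>(K i))"
      by (metis insertI2)
    let ?A = "\<Union>B \<union> (\<Union>i\<in>I. \<Union>(K i))"
    have "finite ?A" using assms(2) insert.hyps K(3) by blast
    then obtain L where L: "Q x L" "finite (\<Union>L)" "F x \<in> L" "\<Union>L \<inter> ?A \<subseteq> F x"
      using insert.prems(2)[of x ?A] by blast
    have Fx: "F x \<subseteq> \<Union>B" using insert.prems(1) by blast
    have "\<Union>L \<inter> \<Union>B = F x" using L(3,4) Fx by blast
    moreover have "\<Union>L \<inter> \<Union>(K i) \<subseteq> \<Union>B" if "i \<in> I" for i
      using L(4) Fx that by blast
    ultimately show ?case
      using K L insert.hyps(2)
      by (intro exI[of _ "K(x := L)"]) (auto simp: Int_commute)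
  qed
  then obtain K where K: "\<forall>i\<in>I. \<Union>(K i) \<inter> \<Union>B = F i"
      "\<forall>i\<in>I. \<forall>j\<in>I. i \<noteq> j \<longrightarrow> \<Union>(K i) \<inter> \<Union>(K j) \<subseteq> \<Union>B"
      "\<forall>i\<in>I. Q i (K i) \<and> finite (\<Union>(K i))"
    by blast
  define G where "G = B \<union> (\<Union>i\<in>I. K i)"
  have G: "attaching B I F K G" using K(1,2) by (simp add: attaching_def G_def)
  have "finite (\<Union>G)" unfolding attaching_Union[OF G] using K(3) assms(1,2) by blast
  then show ?thesis using G K(3) by blast
qed

lemma P_complex_vertices:
  assumes "-1 \<le> k" "k \<le> m"
  shows "\<Union>(P_complex m k) = P_vertices m k"
proof -
  have "F \<subseteq> P_vertices m k" if "F \<in> P_facets m k" for F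
    using that assms
    by (auto simp: P_facets_def P_D1_def P_D2_def P_face_def P_vertices_def)
  moreover have "P_vertices m k \<subseteq> P_D1 m k \<union> P_D2 m k"
    by (auto simp: P_D1_def P_D2_def P_face_def P_vertices_def)
  moreover have "P_D1 m k \<in> P_facets m k" "P_D2 m k \<in> P_facets m k"
    by (auto simp: P_facets_def)
  moreover have "\<Union>(P_complex m k) = \<Union>(P_facets m k)" by (auto simp: P_complex_def)
  ultimately show ?thesis by (metis Sup_le_iff Un_least Union_upper equalityI order_trans)
qed

lemma P_labelling_exists:
  assumes "infinite (UNIV :: 'a set)" "-1 \<le> k" "k \<le> m"
    and D: "finite D" "int (card D) = m + 1" and \<sigma>: "\<sigma> \<subseteq> D" "int (card \<sigma>) = k + 1"
    and A: "finite (A :: 'a set)"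
  shows "\<exists>g. inj_on g (P_vertices m k) \<and> g ` P_D2 m k = D \<and> g ` P_face m k = \<sigma> \<and>
    g ` P_vertices m k \<inter> A \<subseteq> D"
proof -
  let ?S = "P_face m k" and ?M = "{m - k + 1..2*m - 2*k}" and ?N = "{1..m - k}"
  have fin: "finite \<sigma>" using D(1) \<sigma>(1) finite_subset by blast
  have "card ?S = card \<sigma>" using \<sigma>(2) assms(2) by (simp add: P_face_def)
  then obtain g1 where g1: "bij_betw g1 ?S \<sigma>"
    using fin by (metis P_face_def finite_atLeastAtMost_int finite_same_card_bij)
  have "card ?M = card (D - \<sigma>)"
    using D \<sigma> fin by (simp add: card_Diff_subset nat_diff_distrib)
  then obtain g2 where g2: "bij_betw g2 ?M (D - \<sigma>)"
    using D(1) by (metis finite_Diff finite_atLeastAtMost_int finite_same_card_bij)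
  have "infinite (UNIV - (A \<union> D))" using assms(1) A D(1) by (simp add: Diff_infinite_finite)
  then obtain T where T: "T \<subseteq> UNIV - (A \<union> D)" "finite T" "card T = card ?N"
    by (metis infinite_arbitrarily_large)
  then obtain g3 where g3: "bij_betw g3 ?N T"
    by (metis finite_atLeastAtMost_int finite_same_card_bij)
  define g where "g v = (if v \<in> ?S then g1 v else if v \<in> ?M then g2 v else g3 v)" for v
  have dis: "?S \<inter> ?M = {}" "?N \<inter> (?S \<union> ?M) = {}"
    using assms(2,3) by (auto simp: P_face_def)
  have 1: "bij_betw g ?S \<sigma>" using g1 by (rule bij_betw_cong[THEN iffD1, rotated]) (simp add: g_def)
  have 2: "bij_betw g ?M (D - \<sigma>)"
    using g2 by (rule bij_betw_cong[THEN iffD1, rotated]) (use dis in \<open>auto simp: g_def\<close>)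
  have 3: "bij_betw g ?N T"
    using g3 by (rule bij_betw_cong[THEN iffD1, rotated]) (use dis in \<open>auto simp: g_def\<close>)
  have V: "P_vertices m k = ?N \<union> (?M \<union> ?S)"
    using assms(2,3) by (auto simp: P_vertices_def P_face_def)
  have 4: "bij_betw g (?M \<union> ?S) D"
    using bij_betw_combine[OF 2 1] \<sigma>(1) by (simp add: Un_absorb2 Diff_disjoint[THEN trans[OF Int_commute]])
  have 5: "bij_betw g (P_vertices m k) (T \<union> D)"
    unfolding V by (rule bij_betw_combine[OF 3 4]) (use T in blast)
  show ?thesis
    using 1 4 5 T(1) by (intro exI[of _ g]) (auto simp: bij_betw_def P_D2_def)
qed

lemma E_copy_exists:
  assumes "infinite (UNIV :: 'a set)" "-1 \<le> k" "k \<le> m"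
    and "finite D" "int (card D) = m + 1" "\<sigma> \<subseteq> D" "int (card \<sigma>) = k + 1"
    and "finite (A :: 'a set)"
  shows "\<exists>K. E_copy m k K D \<sigma> \<and> finite (\<Union>K) \<and> D \<in> K \<and> \<Union>K \<inter> A \<subseteq> D"
  using assms(2-)
proof (induction "nat (m - k)" arbitrary: k D \<sigma> A rule: less_induct)
  case less
  obtain g where g: "inj_on g (P_vertices m k)" "g ` P_D2 m k = D" "g ` P_face m k = \<sigma>"
      "g ` P_vertices m k \<inter> A \<subseteq> D"
    using P_labelling_exists[OF assms(1) less.prems] by blast
  let ?B = "(\<lambda>\<rho>. g ` \<rho>) ` P_complex m k"
  have UB: "\<Union>?B = g ` P_vertices m k"
    using P_complex_vertices[OF less.prems(1,2)] by (simp flip: image_Union)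
  have finB: "finite (\<Union>?B)" by (simp add: UB P_vertices_def)
  have DB: "g ` P_D1 m k \<in> ?B" "D \<in> ?B"
    using g(2) by (auto simp: P_complex_def P_facets_def)
  show ?case
  proof (cases "k = m")
    case True
    have "E_copy m k ?B D \<sigma>"
      using E_base[of m g] g less.prems(1) True by simp
    then show ?thesis using finB DB g(4) UB by metis
  next
    case False
    let ?D = "g ` P_D1 m k" and ?I = "{\<tau>. g ` P_face m k \<subset> \<tau> \<and> \<tau> \<subseteq> g ` P_D1 m k}"
    have finD: "finite ?D" by (simp add: P_D1_def P_face_def)
    have subD: "P_D1 m k \<subseteq> P_vertices m k"
      using less.prems(1,2) by (auto simp: P_D1_def P_face_def P_vertices_def)
    have "card ?D = card (P_D1 m k)"
      using g(1) subD by (meson card_image inj_on_subset)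
    also have "\<dots> = card {1..m - k} + card (P_face m k)"
      unfolding P_D1_def
      by (rule card_Un_disjoint) (use less.prems(1,2) in \<open>auto simp: P_face_def\<close>)
    also have "int \<dots> = m + 1" using less.prems(1,2) by (simp add: P_face_def)
    finally have cardD: "int (card ?D) = m + 1" by simp
    have ex: "\<exists>K. E_copy m (face_dim \<tau>) K ?D \<tau> \<and> finite (\<Union>K) \<and> ?D \<in> K \<and> \<Union>K \<inter> A' \<subseteq> ?D"
      if \<tau>: "\<tau> \<in> ?I" and A': "finite A'" for \<tau> A'
    proof -
      have fin: "finite \<tau>" using \<tau> finD finite_subset by blast
      have "card (g ` P_face m k) < card \<tau>" using \<tau> fin psubset_card_mono by blast
      moreover have "card \<tau> \<le> card ?D" using \<tau> finD card_mono by blast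
      ultimately have b: "k < face_dim \<tau>" "face_dim \<tau> \<le> m"
        using less.prems(6) g(3) cardD by (auto simp: face_dim_def)
      show ?thesis
        by (rule less.hyps) (use b \<tau> less.prems(1) finD cardD A' in \<open>auto simp: face_dim_def\<close>)
    qed
    have finI: "finite ?I" using finD by (auto intro: finite_subset[of _ "Pow ?D"])
    obtain K G where KG: "attaching ?B ?I (\<lambda>_. ?D) K G"
      "\<forall>\<tau>\<in>?I. E_copy m (face_dim \<tau>) (K \<tau>) ?D \<tau> \<and> \<Union>(K \<tau>) \<inter> A \<subseteq> ?D" "finite (\<Union>G)"
    proof -
      have "\<exists>K G. attaching ?B ?I (\<lambda>_. ?D) K G \<and>
        (\<forall>\<tau>\<in>?I. E_copy m (face_dim \<tau>) (K \<tau>) ?D \<tau> \<and> \<Union>(K \<tau>) \<inter> A \<subseteq> ?D) \<and> finite (\<Union>G)"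
      proof (rule attaching_exists[OF finI finB])
        fix \<tau> assume "\<tau> \<in> ?I"
        show "?D \<subseteq> \<Union>?B" using DB(1) by blast
      next
        fix \<tau> and A' :: "'a set" assume t: "\<tau> \<in> ?I" and "finite A'"
        then have "finite (A' \<union> A)" using less.prems(7) by simp
        from ex[OF t this]
        show "\<exists>K. (E_copy m (face_dim \<tau>) K ?D \<tau> \<and> \<Union>K \<inter> A \<subseteq> ?D) \<and> finite (\<Union>K) \<and>
          ?D \<in> K \<and> \<Union>K \<inter> A' \<subseteq> ?D"
          by (elim exE) (rule exI, blast)
      qed
      then show ?thesis using that by blast
    qed
    have "E_copy m k G D \<sigma>"
      using E_step[of k m g K G] KG(1,2) g less.prems(1,2) False by auto
    moreover have "D \<in> G" using DB(2) KG(1) by (simp add: attaching_def)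
    moreover have "\<Union>G \<inter> A \<subseteq> D"
    proof -
      have "?D \<inter> A \<subseteq> D" using g(4) subD by blast
      moreover have "\<Union>?B \<inter> A \<subseteq> D" using g(4) UB by simp
      moreover have "\<Union>(K \<tau>) \<inter> A \<subseteq> ?D \<inter> A" if "\<tau> \<in> ?I" for \<tau>
        using KG(2) that by (meson Int_greatest Int_lower2)
      ultimately have *: "v \<in> D" if "v \<in> \<Union>?B \<or> (\<exists>\<tau>\<in>?I. v \<in> \<Union>(K \<tau>))" "v \<in> A" for v
        using that by (meson IntI subsetD)
      show ?thesis
      proof
        fix v assume "v \<in> \<Union>G \<inter> A"
        then have v: "v \<in> \<Union>G" "v \<in> A" by (simp_all only: Int_iff)
        from v(1) have "v \<in> \<Union>?B \<or> (\<exists>\<tau>\<in>?I. v \<in> \<Union>(K \<tau>))"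
          unfolding attaching_Union[OF KG(1)] Un_iff UN_iff .
        then show "v \<in> D" using v(2) by (rule *)
      qed
    qed
    ultimately show ?thesis using KG(3) by blast
  qed
qed

theorem partition_extender_exists:
  fixes \<Delta> :: "'a set set"
  assumes "infinite (UNIV :: 'a set)" "simplicial_complex \<Delta>"
  shows "\<exists>\<Gamma>. partition_extender \<Delta> \<Gamma>"
proof -
  have fin: "finite (\<Union>\<Delta>)" using assms(2) by (simp add: simplicial_complex_def)
  then have fin\<Delta>: "finite \<Delta>" by (simp add: finite_UnionD)
  have finface: "finite \<sigma>" if "\<sigma> \<in> \<Delta>" for \<sigma>
    using fin that by (meson Union_upper finite_subset)
  have "\<exists>F. facet \<Delta> F \<and> face_dim F = degree_dim \<Delta> \<sigma> \<and> \<sigma> \<subseteq> F" if \<sigma>: "\<sigma> \<in> \<Delta>" for \<sigma>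
  proof -
    let ?S = "{face_dim \<tau> |\<tau>. \<tau> \<in> \<Delta> \<and> \<sigma> \<subseteq> \<tau>}"
    have S: "finite ?S" "?S \<noteq> {}" using fin\<Delta> \<sigma> by auto
    then obtain F where F: "F \<in> \<Delta>" "\<sigma> \<subseteq> F" "face_dim F = degree_dim \<Delta> \<sigma>"
      using Max_in[OF S] by (auto simp: degree_dim_def)
    have "G = F" if G: "G \<in> \<Delta>" "F \<subseteq> G" for G
    proof -
      have "face_dim G \<le> face_dim F"
        unfolding F(3) degree_dim_def by (rule Max_ge[OF S(1)]) (use G F in blast)
      then show ?thesis using G finface[of G] card_seteq[of G F] by (simp add: face_dim_def)
    qed
    then show ?thesis using F by (auto simp: facet_def)
  qed
  then obtain F where F: "\<And>\<sigma>. \<sigma> \<in> \<Delta> \<Longrightarrow>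
      facet \<Delta> (F \<sigma>) \<and> face_dim (F \<sigma>) = degree_dim \<Delta> \<sigma> \<and> \<sigma> \<subseteq> F \<sigma>"
    by metis
  have "\<exists>K G. attaching \<Delta> \<Delta> F K G \<and>
      (\<forall>\<sigma>\<in>\<Delta>. E_copy (degree_dim \<Delta> \<sigma>) (face_dim \<sigma>) (K \<sigma>) (F \<sigma>) \<sigma>) \<and> finite (\<Union>G)"
  proof (rule attaching_exists[OF fin\<Delta> fin])
    fix \<sigma> assume "\<sigma> \<in> \<Delta>"
    then show "F \<sigma> \<subseteq> \<Union>\<Delta>" using F by (auto simp: facet_def)
  next
    fix \<sigma> and A :: "'a set" assume \<sigma>: "\<sigma> \<in> \<Delta>" and A: "finite A"
    have FF: "F \<sigma> \<in> \<Delta>" "\<sigma> \<subseteq> F \<sigma>" "face_dim (F \<sigma>) = degree_dim \<Delta> \<sigma>"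
      using F[OF \<sigma>] by (auto simp: facet_def)
    have "card \<sigma> \<le> card (F \<sigma>)" using FF finface card_mono by blast
    then show "\<exists>K. E_copy (degree_dim \<Delta> \<sigma>) (face_dim \<sigma>) K (F \<sigma>) \<sigma> \<and> finite (\<Union>K) \<and>
        F \<sigma> \<in> K \<and> \<Union>K \<inter> A \<subseteq> F \<sigma>"
      using FF finface[OF FF(1)] A by (intro E_copy_exists assms(1)) (auto simp: face_dim_def)
  qed
  then show ?thesis using F unfolding partition_extender_def by metis
qed

end

theory Submission
  imports Defs
begin

text \<open>
  The \<open>f\<close>-triangle of \<open>\<Gamma>\<close> is the sum of those of \<open>\<Delta>\<close> and of \<open>(\<Gamma>, \<Delta>)\<close>, because the
  attachments do not change the degree of a face of \<open>\<Delta>\<close>, and the removal of \<open>\<Delta>\<close> does not change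
  the degree of a remaining face. The \<open>h\<close>-triangle is linear in
  the \<open>f\<close>-triangle, and an \<open>h\<close>-compatible partitioning has, by definition, as many
  \<open>(i,j)\<close>-intervals as the \<open>h\<close>-triangle says. So the formula holds for any two such partitionings,
  and the substance is that they exist.

  A partitioning is \<open>h\<close>-compatible as soon as each interval ends in a facet of the largest
  dimension possible above its bottom element (\<open>h_compatible_if_interval_decomposable\<close>): then
  each interval contributes to one row of the \<open>f\<close>-triangle only, and the \<open>h\<close>-vector of a single
  Boolean interval is a unit vector.

  Such partitionings come from a property of \<open>E(m,k)\<close> (\<open>E_copy_partition_gadget\<close>): the faces
  outside its specified facet can be partitioned into intervals with tops of dimension \<open>m\<close>, and so
  can these faces together with the specified face. Using the first option for every attached
  complex partitions \<open>(\<Gamma>, \<Delta>)\<close>, and using the second one partitions \<open>\<Gamma>\<close>, because every face of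
  \<open>\<Delta>\<close> is the specified face of exactly one attached complex. The property follows by induction
  along the construction: the interval from the specified face to \<open>D\<^sub>1\<close> covers, besides that face,
  precisely the faces to which smaller gadgets are attached, so using it amounts to switching all
  of these gadgets to their other option. The remaining faces of \<open>P(m,k)\<close> need no switching and are
  partitioned explicitly (\<open>P_window_faces_decomposable\<close>).
\<close>

section \<open>Decompositions into Boolean intervals\<close>

text \<open>A partition of a family of sets into Boolean intervals, with the dimension of each top element
  prescribed by \<open>d\<close> at the bottom element. The intervals are full intervals \<open>{\<sigma>..\<tau>}\<close> of the
  power set, so that the notion refers to no ambient complex and pieces of different complexes
  can be put together.\<close>

definition interval_decomposable :: "('a set \<Rightarrow> int) \<Rightarrow> 'a set set \<Rightarrow> bool" where
  "interval_decomposable d A \<longleftrightarrow> (\<exists>\<P>. partition_on A \<P> \<and>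
     (\<forall>I\<in>\<P>. \<exists>\<sigma> \<tau>. finite \<tau> \<and> \<sigma> \<subseteq> \<tau> \<and> face_dim \<tau> = d \<sigma> \<and> I = {\<sigma>..\<tau>}))"

lemma interval_decomposable_empty: "interval_decomposable d {}"
  by (auto simp: interval_decomposable_def partition_on_empty)

lemma interval_decomposable_interval:
  assumes "finite \<tau>" "\<sigma> \<subseteq> \<tau>" "face_dim \<tau> = d \<sigma>"
  shows "interval_decomposable d {\<sigma>..\<tau>}"
  unfolding interval_decomposable_def
  by (rule exI[of _ "{{\<sigma>..\<tau>}}"]) (use assms in \<open>auto intro!: partition_on_space\<close>)

lemma interval_decomposable_UN:
  assumes dec: "\<And>i. i \<in> S \<Longrightarrow> interval_decomposable d (A i)"
    and dis: "\<And>i j. i \<in> S \<Longrightarrow> j \<in> S \<Longrightarrow> i \<noteq> j \<Longrightarrow> A i \<inter> A j = {}"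
  shows "interval_decomposable d (\<Union>i\<in>S. A i)"
proof -
  have "\<forall>i\<in>S. \<exists>\<P>. partition_on (A i) \<P> \<and>
     (\<forall>I\<in>\<P>. \<exists>\<sigma> \<tau>. finite \<tau> \<and> \<sigma> \<subseteq> \<tau> \<and> face_dim \<tau> = d \<sigma> \<and> I = {\<sigma>..\<tau>})"
    using dec by (simp add: interval_decomposable_def)
  then obtain \<P> where part: "\<And>i. i \<in> S \<Longrightarrow> partition_on (A i) (\<P> i)"
    and int: "\<And>i I. i \<in> S \<Longrightarrow> I \<in> \<P> i \<Longrightarrow>
      \<exists>\<sigma> \<tau>. finite \<tau> \<and> \<sigma> \<subseteq> \<tau> \<and> face_dim \<tau> = d \<sigma> \<and> I = {\<sigma>..\<tau>}"
    by metis
  have "partition_on (\<Union>i\<in>S. A i) (\<Union>i\<in>S. \<P> i)"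
  proof (rule partition_onI)
    show "\<Union>(\<Union>i\<in>S. \<P> i) = (\<Union>i\<in>S. A i)"
      using part[THEN partition_onD1] by blast
    show "{} \<notin> (\<Union>i\<in>S. \<P> i)" using part[THEN partition_onD3] by blast
    fix p q assume p: "p \<in> (\<Union>i\<in>S. \<P> i)" and q: "q \<in> (\<Union>i\<in>S. \<P> i)" and ne: "p \<noteq> q"
    from p q obtain i j where ij: "i \<in> S" "j \<in> S" "p \<in> \<P> i" "q \<in> \<P> j" by blast
    show "disjnt p q"
    proof (cases "i = j")
      case True
      then show ?thesis using part[OF ij(1)] ij ne
        by (auto simp: partition_on_def pairwise_def)
    next
      case False
      have "p \<subseteq> A i" "q \<subseteq> A j" using part[THEN partition_onD1] ij by blast+
      then show ?thesis using dis[OF ij(1,2) False] by (auto simp: disjnt_def)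
    qed
  qed
  then show ?thesis using int unfolding interval_decomposable_def by blast
qed

lemma interval_decomposable_Un:
  assumes "interval_decomposable d A" "interval_decomposable d B" "A \<inter> B = {}"
  shows "interval_decomposable d (A \<union> B)"
proof -
  have "interval_decomposable d (\<Union>b\<in>UNIV. if b then A else B)"
    by (rule interval_decomposable_UN) (use assms in \<open>auto split: if_splits\<close>)
  then show ?thesis by (simp add: UNIV_bool Un_commute)
qed

text \<open>The inductive construction works with a constant \<open>d\<close>; this is the passage to
  \<open>d = degree_dim X\<close>, which varies over a nonpure complex.\<close>

lemma interval_decomposable_cong:
  assumes "interval_decomposable d A" "\<And>\<rho>. \<rho> \<in> A \<Longrightarrow> d \<rho> = d' \<rho>"
  shows "interval_decomposable d' A"
proof -
  obtain \<P> where P: "partition_on A \<P>"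
     "\<And>I. I\<in>\<P> \<Longrightarrow> \<exists>\<sigma> \<tau>. finite \<tau> \<and> \<sigma> \<subseteq> \<tau> \<and> face_dim \<tau> = d \<sigma> \<and> I = {\<sigma>..\<tau>}"
    using assms(1) by (auto simp: interval_decomposable_def)
  have "\<exists>\<sigma> \<tau>. finite \<tau> \<and> \<sigma> \<subseteq> \<tau> \<and> face_dim \<tau> = d' \<sigma> \<and> I = {\<sigma>..\<tau>}" if I: "I \<in> \<P>" for I
  proof -
    obtain \<sigma> \<tau> where *: "finite \<tau>" "\<sigma> \<subseteq> \<tau>" "face_dim \<tau> = d \<sigma>" "I = {\<sigma>..\<tau>}"
      using P(2)[OF I] by blast
    then have "\<sigma> \<in> A" using I partition_onD1[OF P(1)] by auto
    then show ?thesis using * assms(2) by auto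
  qed
  then show ?thesis using P(1) unfolding interval_decomposable_def by blast
qed

lemma interval_decomposable_obtains_top:
  assumes "interval_decomposable (\<lambda>_. m) A" "\<rho> \<in> A"
  obtains \<tau> where "\<tau> \<in> A" "\<rho> \<subseteq> \<tau>" "face_dim \<tau> = m"
proof -
  obtain \<P> where P: "partition_on A \<P>"
     "\<And>I. I\<in>\<P> \<Longrightarrow> \<exists>\<sigma> \<tau>. finite \<tau> \<and> \<sigma> \<subseteq> \<tau> \<and> face_dim \<tau> = m \<and> I = {\<sigma>..\<tau>}"
    using assms(1) by (auto simp: interval_decomposable_def)
  obtain I where I: "I \<in> \<P>" "\<rho> \<in> I" using assms(2) partition_onD1[OF P(1)] by auto
  then obtain \<sigma> \<tau> where *: "\<sigma> \<subseteq> \<tau>" "face_dim \<tau> = m" "I = {\<sigma>..\<tau>}" using P(2) by blast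
  have "\<tau> \<in> A" using * I partition_onD1[OF P(1)] by auto
  then show thesis using that * I by auto
qed

lemma image_face_interval_inj:
  assumes "inj_on g V" "\<tau> \<subseteq> V" "\<sigma> \<subseteq> \<tau>"
  shows "(`) g ` {\<sigma>..\<tau>} = {g ` \<sigma>..g ` \<tau>}"
proof (intro equalityI subsetI)
  fix \<rho> assume "\<rho> \<in> {g ` \<sigma>..g ` \<tau>}"
  then have sub: "g ` \<sigma> \<subseteq> \<rho>" "\<rho> \<subseteq> g ` \<tau>" by auto
  then obtain \<rho>' where \<rho>': "\<rho>' \<subseteq> \<tau>" "\<rho> = g ` \<rho>'" by (meson subset_imageE)
  then have "\<sigma> \<subseteq> \<rho>'"
    using sub(1) inj_on_image_mem_iff[OF assms(1), of _ \<rho>'] assms(2,3) by blast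
  then show "\<rho> \<in> (`) g ` {\<sigma>..\<tau>}" using \<rho>' by auto
next
  fix \<rho> assume "\<rho> \<in> (`) g ` {\<sigma>..\<tau>}"
  then obtain \<rho>' where "\<rho> = g ` \<rho>'" "\<sigma> \<subseteq> \<rho>'" "\<rho>' \<subseteq> \<tau>" by auto
  then show "\<rho> \<in> {g ` \<sigma>..g ` \<tau>}" by (simp add: image_mono)
qed

lemma interval_decomposable_image:
  assumes dec: "interval_decomposable (\<lambda>_. m) A" and g: "inj_on g V" and V: "\<Union>A \<subseteq> V"
  shows "interval_decomposable (\<lambda>_. m) ((`) g ` A)"
proof -
  obtain \<P> where P: "partition_on A \<P>"
     "\<And>I. I\<in>\<P> \<Longrightarrow> \<exists>\<sigma> \<tau>. finite \<tau> \<and> \<sigma> \<subseteq> \<tau> \<and> face_dim \<tau> = m \<and> I = {\<sigma>..\<tau>}"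
    using dec by (auto simp: interval_decomposable_def)
  have "inj_on ((`) g) A"
    by (rule inj_on_subset[OF inj_on_image_Pow[OF g]]) (use V in blast)
  from partition_on_inj_image[OF P(1) this]
  have part: "partition_on ((`) g ` A) ((`) ((`) g) ` \<P> - {{}})" .
  have int: "\<forall>J\<in>(`) ((`) g) ` \<P> - {{}}.
      \<exists>\<sigma> \<tau>. finite \<tau> \<and> \<sigma> \<subseteq> \<tau> \<and> face_dim \<tau> = m \<and> J = {\<sigma>..\<tau>}"
  proof
    fix J assume J: "J \<in> (`) ((`) g) ` \<P> - {{}}"
    obtain I where I: "I \<in> \<P>" "J = (`) g ` I" using J by auto
    obtain \<sigma> \<tau> where *: "finite \<tau>" "\<sigma> \<subseteq> \<tau>" "face_dim \<tau> = m" "I = {\<sigma>..\<tau>}"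
      using P(2)[OF I(1)] by blast
    have "\<tau> \<in> A" using * I(1) partition_onD1[OF P(1)] by auto
    then have "\<tau> \<subseteq> V" using V by blast
    then have "J = {g ` \<sigma>..g ` \<tau>}"
      using image_face_interval_inj[OF g _ *(2)] I(2) *(4) by simp
    moreover have "card (g ` \<tau>) = card \<tau>"
      by (rule card_image[OF inj_on_subset[OF g \<open>\<tau> \<subseteq> V\<close>]])
    ultimately show "\<exists>\<sigma> \<tau>. finite \<tau> \<and> \<sigma> \<subseteq> \<tau> \<and> face_dim \<tau> = m \<and> J = {\<sigma>..\<tau>}"
      using * by (intro exI[of _ "g ` \<sigma>"] exI[of _ "g ` \<tau>"]) (simp add: face_dim_def image_mono)
  qed
  show ?thesis unfolding interval_decomposable_def by (rule exI, rule conjI, rule part, rule int)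
qed

section \<open>The h-triangle of a decomposed family\<close>

text \<open>The sets in the interval correspond to the subsets of \<open>\<tau> - \<sigma>\<close>.\<close>

lemma card_interval_by_size:
  assumes "finite \<tau>" "\<sigma> \<subseteq> \<tau>"
  shows "card {\<rho> \<in> {\<sigma>..\<tau>}. card \<rho> = k} =
    (if card \<sigma> \<le> k then (card \<tau> - card \<sigma>) choose (k - card \<sigma>) else 0)"
proof (cases "card \<sigma> \<le> k")
  case True
  have fin: "finite \<sigma>" using assms finite_subset by blast
  have "card (\<alpha> \<union> \<sigma>) = card \<alpha> + card \<sigma>" if "\<alpha> \<subseteq> \<tau> - \<sigma>" for \<alpha>
    using that fin finite_subset[OF that] assms(1) by (intro card_Un_disjoint) auto
  then have "bij_betw (\<lambda>\<alpha>. \<alpha> \<union> \<sigma>) {\<alpha>. \<alpha> \<subseteq> \<tau> - \<sigma> \<and> card \<alpha> = k - card \<sigma>}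
      {\<rho> \<in> {\<sigma>..\<tau>}. card \<rho> = k}"
    using True assms(2) fin
    by (intro bij_betw_byWitness[where f' = "\<lambda>\<rho>. \<rho> - \<sigma>"]) (auto simp: card_Diff_subset)
  then have "card {\<rho> \<in> {\<sigma>..\<tau>}. card \<rho> = k} = card {\<alpha>. \<alpha> \<subseteq> \<tau> - \<sigma> \<and> card \<alpha> = k - card \<sigma>}"
    by (simp add: bij_betw_same_card)
  also have "\<dots> = card (\<tau> - \<sigma>) choose (k - card \<sigma>)"
    using assms(1) by (simp add: n_subsets)
  finally show ?thesis using True fin assms(2) by (simp add: card_Diff_subset)
next
  case False
  have "card \<sigma> \<le> card \<rho>" if "\<rho> \<in> {\<sigma>..\<tau>}" for \<rho>
    using that finite_subset[OF _ assms(1), of \<rho>] by (simp add: card_mono)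
  then show ?thesis using False by (auto simp: card_eq_0_iff)
qed

text \<open>By \<open>card_interval_by_size\<close>, the left-hand side is the \<open>j\<close>-th \<open>h\<close>-number of a single Boolean
  interval from a set of size \<open>l\<close> to a set of size \<open>i\<close>; it detects the size of the bottom element.
  The product of the two binomial coefficients is \<open>(i - l choose j - l) * (j - l choose j - k)\<close>, of
  which only the second factor depends on \<open>k\<close>, and the alternating sum of a row of Pascal's
  triangle vanishes unless \<open>j = l\<close>.\<close>

lemma alternating_binomial_inversion:
  assumes "l \<le> (i::nat)"
  shows "(\<Sum>k = 0..j. (-1) ^ (j - k) * int ((i - k) choose (j - k)) *
      int (if l \<le> k then (i - l) choose (k - l) else 0)) = (if l = j then 1 else 0)"
    (is "?S = _")
proof (cases "l \<le> j")
  case False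
  then show ?thesis by (intro trans[OF sum.neutral]) auto
next
  case lj: True
  have "?S = (\<Sum>k = l..j. (-1) ^ (j - k) * int ((i - k) choose (j - k)) *
      int ((i - l) choose (k - l)))"
    using lj by (intro sum.mono_neutral_cong_right) auto
  also have "\<dots> = (\<Sum>k = l..j. int ((i - l) choose (j - l)) *
      ((-1) ^ (j - k) * int ((j - l) choose (j - k))))"
  proof (rule sum.cong[OF refl])
    fix k assume "k \<in> {l..j}"
    then have k: "l \<le> k" "k \<le> j" by auto
    have eq: "((i - k) choose (j - k)) * ((i - l) choose (k - l)) =
        ((i - l) choose (j - l)) * ((j - l) choose (j - k))"
    proof (cases "j \<le> i")
      case True
      have "((i - l) choose (j - l)) * ((j - l) choose (k - l)) =
          ((i - l) choose (k - l)) * ((i - l - (k - l)) choose (j - l - (k - l)))"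
        by (rule choose_mult) (use k True in auto)
      moreover have "((j - l) choose (k - l)) = ((j - l) choose (j - k))"
        using binomial_symmetric[of "k - l" "j - l"] k by simp
      ultimately show ?thesis using k by (simp add: mult.commute)
    next
      case False
      \<comment> \<open>Truncated subtraction makes \<open>i - k = 0\<close> for \<open>k > i\<close>; there the other factor vanishes.\<close>
      then have "k \<le> i \<Longrightarrow> ((i - k) choose (j - k)) = 0" "\<not> k \<le> i \<Longrightarrow> ((i - l) choose (k - l)) = 0"
        "((i - l) choose (j - l)) = 0"
        using k assms by (auto intro!: binomial_eq_0)
      then show ?thesis by (cases "k \<le> i") (simp_all only: mult_zero_left mult_zero_right simp_thms)
    qed
    show "(-1) ^ (j - k) * int ((i - k) choose (j - k)) * int ((i - l) choose (k - l)) =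
        int ((i - l) choose (j - l)) * ((-1) ^ (j - k) * int ((j - l) choose (j - k)))"
      unfolding mult.assoc of_nat_mult[symmetric] eq
      unfolding of_nat_mult by (rule mult.left_commute)
  qed
  also have "\<dots> = int ((i - l) choose (j - l)) *
      (\<Sum>k = l..j. (-1) ^ (j - k) * int ((j - l) choose (j - k)))"
    by (simp add: sum_distrib_left)
  also have "(\<Sum>k = l..j. (-1) ^ (j - k) * int ((j - l) choose (j - k))) =
      (\<Sum>n\<le>j - l. (-1) ^ n * int ((j - l) choose n))"
    using lj
    by (intro sum.reindex_bij_witness[where i = "\<lambda>n. j - n" and j = "\<lambda>k. j - k"]) auto
  finally show ?thesis
    using lj choose_alternating_sum[of "j - l", where ?'a = int] by (cases "l = j") auto
qed

lemma boolean_interval_finite: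
  assumes "finite \<tau>" "\<sigma> \<subseteq> \<tau>" "{\<sigma>..\<tau>} \<subseteq> X"
  shows "boolean_interval X \<sigma> \<tau>" and "face_interval X \<sigma> \<tau> = {\<sigma>..\<tau>}"
proof -
  show I: "face_interval X \<sigma> \<tau> = {\<sigma>..\<tau>}" using assms(3) by (auto simp: face_interval_def)
  obtain e :: "'a \<Rightarrow> nat" where e: "bij_betw e (\<tau> - \<sigma>) {0..<card (\<tau> - \<sigma>)}"
    using assms(1) ex_bij_betw_finite_nat by blast
  let ?S = "{0..<card (\<tau> - \<sigma>)}" and ?\<phi> = "\<lambda>\<rho>. e ` (\<rho> - \<sigma>)"
  have "bij_betw (\<lambda>\<rho>. \<rho> - \<sigma>) {\<sigma>..\<tau>} (Pow (\<tau> - \<sigma>))"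
    using assms(2) by (intro bij_betw_byWitness[where f' = "\<lambda>\<alpha>. \<alpha> \<union> \<sigma>"]) auto
  from bij_betw_trans[OF this bij_betw_Pow[OF e]]
  have "bij_betw ?\<phi> {\<sigma>..\<tau>} (Pow ?S)" by (simp add: comp_def)
  moreover have "\<alpha> \<subseteq> \<beta> \<longleftrightarrow> ?\<phi> \<alpha> \<subseteq> ?\<phi> \<beta>" if "\<alpha> \<in> {\<sigma>..\<tau>}" "\<beta> \<in> {\<sigma>..\<tau>}" for \<alpha> \<beta>
  proof -
    have "?\<phi> \<alpha> \<subseteq> ?\<phi> \<beta> \<longleftrightarrow> \<alpha> - \<sigma> \<subseteq> \<beta> - \<sigma>"
    proof
      assume sub: "?\<phi> \<alpha> \<subseteq> ?\<phi> \<beta>"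
      show "\<alpha> - \<sigma> \<subseteq> \<beta> - \<sigma>"
      proof
        fix x assume x: "x \<in> \<alpha> - \<sigma>"
        then have "e x \<in> ?\<phi> \<beta>" using sub by blast
        moreover have "x \<in> \<tau> - \<sigma>" "\<beta> - \<sigma> \<subseteq> \<tau> - \<sigma>" using x that by auto
        ultimately show "x \<in> \<beta> - \<sigma>"
          using inj_on_image_mem_iff[OF bij_betw_imp_inj_on[OF e]] by metis
      qed
    qed (rule image_mono)
    also have "\<dots> \<longleftrightarrow> \<alpha> \<subseteq> \<beta>" using that by auto
    finally show ?thesis ..
  qed
  moreover have "\<sigma> \<in> X" "\<tau> \<in> X" using assms(2,3) by auto
  ultimately show "boolean_interval X \<sigma> \<tau>"
    unfolding boolean_interval_def I using assms(2) finite_atLeastLessThan by blast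
qed

text \<open>An interval, as a set of faces, determines its least and its greatest element.\<close>

lemma ij_interval_iff:
  assumes "finite \<tau>" "\<sigma> \<subseteq> \<tau>" "{\<sigma>..\<tau>} \<subseteq> X" "facet X \<tau>"
  shows "ij_interval X i j {\<sigma>..\<tau>} \<longleftrightarrow> card \<sigma> = j \<and> card \<tau> = i"
proof
  assume "ij_interval X i j {\<sigma>..\<tau>}"
  then obtain \<sigma>' \<tau>' where *: "boolean_interval X \<sigma>' \<tau>'" "{\<sigma>..\<tau>} = face_interval X \<sigma>' \<tau>'"
      "card \<sigma>' = j" "card \<tau>' = i"
    by (auto simp: ij_interval_def)
  have "\<sigma>' \<in> {\<sigma>..\<tau>}" "\<tau>' \<in> {\<sigma>..\<tau>}"
    using *(1) unfolding *(2) by (auto simp: boolean_interval_def face_interval_def)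
  moreover have "\<sigma> \<in> face_interval X \<sigma>' \<tau>'" "\<tau> \<in> face_interval X \<sigma>' \<tau>'"
    unfolding *(2)[symmetric] using assms(2) by auto
  ultimately have "\<sigma>' = \<sigma>" "\<tau>' = \<tau>" by (auto simp: face_interval_def)
  then show "card \<sigma> = j \<and> card \<tau> = i" using * by simp
next
  assume "card \<sigma> = j \<and> card \<tau> = i"
  then show "ij_interval X i j {\<sigma>..\<tau>}"
    using boolean_interval_finite[OF assms(1-3)] assms(4) unfolding ij_interval_def by metis
qed

lemma face_dim_le_degree_dim:
  assumes "finite X" "\<tau> \<in> X" "\<rho> \<subseteq> \<tau>"
  shows "face_dim \<tau> \<le> degree_dim X \<rho>"
  unfolding degree_dim_def by (rule Max_ge) (use assms in auto)

lemma degree_dim_eqI: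
  assumes "finite X" "\<tau> \<in> X" "\<rho> \<subseteq> \<tau>" "face_dim \<tau> = n"
    and "\<And>\<tau>'. \<tau>' \<in> X \<Longrightarrow> \<rho> \<subseteq> \<tau>' \<Longrightarrow> face_dim \<tau>' \<le> n"
  shows "degree_dim X \<rho> = n"
  unfolding degree_dim_def by (rule Max_eqI) (use assms in auto)

text \<open>If every top element has the largest dimension that any face above its bottom element has, then
  \<open>degree_dim\<close> is constant on each interval, because it is antitone. Hence the \<open>f\<close>-triangle is the
  sum of the face numbers of the intervals, row by row according to the size of the top element,
  and \<open>alternating_binomial_inversion\<close> turns the \<open>h\<close>-triangle into the number of intervals with
  a given size of the bottom element. Maximality of the dimension also makes each top element a
  facet.\<close>

theorem h_compatible_if_interval_decomposable:
  assumes fin: "finite X" "\<And>\<rho>. \<rho> \<in> X \<Longrightarrow> finite \<rho>"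
    and dec: "interval_decomposable (degree_dim X) X"
  shows "\<exists>\<P>. h_compatible_partitioning X \<P>"
proof -
  obtain \<P> where P: "partition_on X \<P>"
     "\<And>I. I\<in>\<P> \<Longrightarrow> \<exists>\<sigma> \<tau>. finite \<tau> \<and> \<sigma> \<subseteq> \<tau> \<and> face_dim \<tau> = degree_dim X \<sigma> \<and> I = {\<sigma>..\<tau>}"
    using dec by (auto simp: interval_decomposable_def)
  have finP: "finite \<P>" using finite_elements[OF fin(1) P(1)] .
  define lo where "lo I = (\<Inter>I :: 'a set)" for I :: "'a set set"
  define hi where "hi I = (\<Union>I :: 'a set)" for I :: "'a set set"
  have I: "{lo I..hi I} = I" "lo I \<subseteq> hi I" "finite (hi I)" "I \<subseteq> X"
      "face_dim (hi I) = degree_dim X (lo I)" if I: "I \<in> \<P>" for I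
  proof -
    obtain \<sigma> \<tau> where *: "finite \<tau>" "\<sigma> \<subseteq> \<tau>" "face_dim \<tau> = degree_dim X \<sigma>" "I = {\<sigma>..\<tau>}"
      using P(2)[OF I] by blast
    then have "lo I = \<sigma>" "hi I = \<tau>" by (auto simp: lo_def hi_def)
    then show "{lo I..hi I} = I" "lo I \<subseteq> hi I" "finite (hi I)"
      "face_dim (hi I) = degree_dim X (lo I)" using * by auto
    show "I \<subseteq> X" using I partition_onD1[OF P(1)] by auto
  qed
  have mem: "\<rho> \<in> J \<longleftrightarrow> lo J \<subseteq> \<rho> \<and> \<rho> \<subseteq> hi J" if "J \<in> \<P>" for J \<rho>
    using I(1)[OF that] atLeastAtMost_iff[of \<rho> "lo J" "hi J"] by simp
  have topX: "hi J \<in> X" if J: "J \<in> \<P>" for J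
    using I(2,4)[OF J] mem[OF J, of "hi J"] by blast
  have deg: "degree_dim X \<rho> = face_dim (hi I)" if "I \<in> \<P>" "\<rho> \<in> I" for I \<rho>
  proof (rule degree_dim_eqI[OF fin(1) topX[OF that(1)]])
    have \<rho>: "lo I \<subseteq> \<rho>" "\<rho> \<subseteq> hi I" using that mem by blast+
    then show "\<rho> \<subseteq> hi I" by simp
    show "face_dim \<tau> \<le> face_dim (hi I)" if "\<tau> \<in> X" "\<rho> \<subseteq> \<tau>" for \<tau>
      using face_dim_le_degree_dim[OF fin(1) that(1) order_trans[OF \<rho>(1) that(2)]]
        I(5)[OF \<open>I \<in> \<P>\<close>] by simp
  qed simp
  have facet_top: "facet X (hi I)" if "I \<in> \<P>" for I
  proof -
    have "\<rho> = hi I" if \<rho>: "\<rho> \<in> X" "hi I \<subseteq> \<rho>" for \<rho>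
    proof -
      have "face_dim \<rho> \<le> face_dim (hi I)"
        using face_dim_le_degree_dim[OF fin(1) \<rho>(1)
            order_trans[OF I(2)[OF \<open>I \<in> \<P>\<close>] \<rho>(2)]] I(5)[OF \<open>I \<in> \<P>\<close>] by simp
      then have "card \<rho> \<le> card (hi I)" by (simp add: face_dim_def)
      from card_seteq[OF fin(2)[OF \<rho>(1)] \<rho>(2) this] show ?thesis ..
    qed
    then show ?thesis using topX[OF that] by (auto simp: facet_def)
  qed
  have part: "partitioning X \<P>"
    unfolding partitioning_def
  proof (intro conjI ballI P(1))
    fix J assume J: "J \<in> \<P>"
    have "{lo J..hi J} \<subseteq> X" using I(1,4)[OF J] by simp
    from boolean_interval_finite[OF I(3)[OF J] I(2)[OF J] this]
    show "\<exists>\<sigma> \<tau>. boolean_interval X \<sigma> \<tau> \<and> facet X \<tau> \<and> J = face_interval X \<sigma> \<tau>"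
      using facet_top[OF J] I(1)[OF J] by metis
  qed
  have ij: "ij_interval X i j J \<longleftrightarrow> card (lo J) = j \<and> card (hi J) = i" if J: "J \<in> \<P>" for i j J
  proof -
    have "{lo J..hi J} \<subseteq> X" using I(1,4)[OF J] by simp
    from ij_interval_iff[OF I(3)[OF J] I(2)[OF J] this facet_top[OF J]]
    show ?thesis unfolding I(1)[OF J] .
  qed
  have count: "int (card {J \<in> \<P>. ij_interval X i j J}) = h_triangle X i j" for i j
  proof -
    \<comment> \<open>The faces counted in row \<open>i\<close> are those covered by the intervals whose top has size \<open>i\<close>.\<close>
    define \<P>i where "\<P>i = {J \<in> \<P>. card (hi J) = i}"
    have finPi: "finite \<P>i" using finP by (simp add: \<P>i_def)
    have f: "f_triangle X i k = (\<Sum>J\<in>\<P>i. card {\<rho> \<in> J. card \<rho> = k})" for k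
    proof -
      have "{\<sigma> \<in> X. degree_dim X \<sigma> = int i - 1 \<and> face_dim \<sigma> = int k - 1} =
          (\<Union>J\<in>\<P>i. {\<rho> \<in> J. card \<rho> = k})"
      proof (intro equalityI subsetI)
        fix \<rho> assume \<rho>: "\<rho> \<in> {\<sigma> \<in> X. degree_dim X \<sigma> = int i - 1 \<and> face_dim \<sigma> = int k - 1}"
        then obtain J where J: "J \<in> \<P>" "\<rho> \<in> J" using partition_onD1[OF P(1)] by auto
        then show "\<rho> \<in> (\<Union>J\<in>\<P>i. {\<rho> \<in> J. card \<rho> = k})"
          using deg[OF J] \<rho> by (auto simp: \<P>i_def face_dim_def)
      next
        fix \<rho> assume "\<rho> \<in> (\<Union>J\<in>\<P>i. {\<rho> \<in> J. card \<rho> = k})"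
        then obtain J where J: "J \<in> \<P>" "card (hi J) = i" "\<rho> \<in> J" "card \<rho> = k"
          by (auto simp: \<P>i_def)
        then show "\<rho> \<in> {\<sigma> \<in> X. degree_dim X \<sigma> = int i - 1 \<and> face_dim \<sigma> = int k - 1}"
          using deg[OF J(1,3)] I(4)[OF J(1)] by (auto simp: face_dim_def)
      qed
      moreover have "disjoint_family_on (\<lambda>J. {\<rho> \<in> J. card \<rho> = k}) \<P>i"
        using partition_onD2[OF P(1)]
        by (simp add: disjoint_family_on_def disjoint_def \<P>i_def) blast
      moreover have "finite J" if "J \<in> \<P>i" for J
        using that finite_subset[OF I(4) fin(1)] by (simp add: \<P>i_def)
      ultimately show ?thesis
        unfolding f_triangle_def
        using finPi by (simp only:) (rule card_UN_disjoint', auto)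
    qed
    have "h_triangle X i j = (\<Sum>J\<in>\<P>i. \<Sum>k = 0..j. (-1) ^ (j - k) *
        int ((i - k) choose (j - k)) * int (card {\<rho> \<in> J. card \<rho> = k}))"
      unfolding h_triangle_def f by (simp only: of_nat_sum sum_distrib_left) (rule sum.swap)
    also have "\<dots> = (\<Sum>J\<in>\<P>i. if card (lo J) = j then 1 else 0)"
    proof (rule sum.cong[OF refl])
      fix J assume "J \<in> \<P>i"
      then have J: "J \<in> \<P>" "card (hi J) = i" by (auto simp: \<P>i_def)
      have le: "card (lo J) \<le> i" using J I(2,3)[OF J(1)] card_mono by blast
      have "card {\<rho> \<in> J. card \<rho> = k} =
          (if card (lo J) \<le> k then (i - card (lo J)) choose (k - card (lo J)) else 0)" for k
        using card_interval_by_size[OF I(3,2)[OF J(1)], of k]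
        unfolding J(2) I(1)[OF J(1)] .
      then show "(\<Sum>k = 0..j. (-1) ^ (j - k) *
        int ((i - k) choose (j - k)) * int (card {\<rho> \<in> J. card \<rho> = k})) =
        (if card (lo J) = j then 1 else 0)"
        using alternating_binomial_inversion[OF le, of j] by (simp only:)
    qed
    also have "\<dots> = int (card {J \<in> \<P>i. card (lo J) = j})"
      using finPi by (simp add: sum.If_cases Int_def)
    also have "{J \<in> \<P>i. card (lo J) = j} = {J \<in> \<P>. ij_interval X i j J}"
      using ij by (auto simp: \<P>i_def)
    finally show ?thesis ..
  qed
  show ?thesis using part count unfolding h_compatible_partitioning_def by blast
qed

section \<open>Decomposing the complexes P(m,k)\<close>

lemma P_complex_subset_face: "\<sigma> \<in> P_complex m k \<Longrightarrow> \<rho> \<subseteq> \<sigma> \<Longrightarrow> \<rho> \<in> P_complex m k"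
  by (auto simp: P_complex_def)

lemma P_facets_subset_vertices:
  assumes "-1 \<le> k" "k \<le> m" "F \<in> P_facets m k"
  shows "F \<subseteq> P_vertices m k"
  using assms P_complex_vertices[OF assms(1,2)] by (auto simp: P_complex_def)

lemma face_dim_P_facet:
  assumes k: "-1 \<le> k" "k \<le> m" and F: "F \<in> P_facets m k"
  shows "face_dim F = m"
proof -
  have disj: "card (A \<union> B) = card A + card B"
    if "A \<inter> B = {}" "finite A" "finite B" for A B :: "int set"
    using that by (rule card_Un_disjoint[rotated 2])
  consider "F = P_D1 m k" | "F = P_D2 m k"
    | a b where "0 \<le> a" "a \<le> m - k - 1" "b \<in> P_face m k"
        "F = {a + 1..a + m - k + 1} \<union> (P_face m k - {b})"
    using F unfolding P_facets_def by blast
  then show ?thesis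
  proof cases
    case 1
    have "card F = card {1..m - k} + card (P_face m k)"
      unfolding 1 P_D1_def by (rule disj) (use k in \<open>auto simp: P_face_def\<close>)
    then show ?thesis using k by (simp add: face_dim_def P_face_def)
  next
    case 2
    have "card F = card {m - k + 1..2*m - 2*k} + card (P_face m k)"
      unfolding 2 P_D2_def by (rule disj) (use k in \<open>auto simp: P_face_def\<close>)
    then show ?thesis using k by (simp add: face_dim_def P_face_def)
  next
    case 3
    have "card F = card {a + 1..a + m - k + 1} + card (P_face m k - {b})"
      unfolding 3(4) by (rule disj) (use k 3 in \<open>auto simp: P_face_def\<close>)
    moreover have "card (P_face m k - {b}) = card (P_face m k) - 1"
      using 3(3) by (simp add: P_face_def)
    moreover have "int (card (P_face m k)) = k + 1" using k by (simp add: P_face_def)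
    moreover have "card (P_face m k) \<noteq> 0" using 3(3) by (auto simp: P_face_def)
    ultimately show ?thesis using k 3(1,2) by (simp add: face_dim_def)
  qed
qed

text \<open>All other facets of \<open>P(m,k)\<close> miss a vertex of the specified face.\<close>

lemma P_complex_above_face:
  assumes k: "-1 \<le> k" "k < m" and \<rho>: "\<rho> \<in> P_complex m k" "P_face m k \<subseteq> \<rho>"
  shows "\<rho> \<subseteq> P_D1 m k \<or> \<rho> \<subseteq> P_D2 m k"
proof -
  obtain F where F: "F \<in> P_facets m k" "\<rho> \<subseteq> F" using \<rho>(1) by (auto simp: P_complex_def)
  have "F = P_D1 m k \<or> F = P_D2 m k"
  proof (rule ccontr)
    assume "\<not> ?thesis"
    then obtain a b where ab: "0 \<le> a" "a \<le> m - k - 1" "b \<in> P_face m k"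
        "F = {a + 1..a + m - k + 1} \<union> (P_face m k - {b})"
      using F(1) by (auto simp: P_facets_def)
    have "b \<in> F" using ab(3) \<rho>(2) F(2) by blast
    then show False using ab by (auto simp: P_face_def)
  qed
  then show ?thesis using F(2) by auto
qed

lemma P_D1_inter_P_D2: "P_D1 m k \<inter> P_D2 m k = P_face m k"
  by (auto simp: P_D1_def P_D2_def P_face_def)

text \<open>The vertices up to \<open>2 * (m - k)\<close> form a path, whose windows of length \<open>m - k + 1\<close> are the first
  parts of the facets. A face \<open>\<rho>\<close> that does not lie in \<open>D\<^sub>2\<close> has its smallest vertex \<open>a + 1\<close> among
  the first \<open>m - k\<close> vertices, and its path vertices then lie in the window starting at \<open>a + 1\<close>,
  whatever facet \<open>\<rho>\<close> came from. If \<open>\<rho>\<close> does not contain \<open>\<sigma>\<^sub>0\<close>, let \<open>b\<close> be the smallest vertex of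
  \<open>\<sigma>\<^sub>0\<close> that is missing. The pair \<open>(a, b)\<close> determines the interval of \<open>\<rho>\<close>: its top element is the
  facet given by \<open>a\<close> and \<open>b\<close>, and its bottom element consists of \<open>a + 1\<close> and the vertices of
  \<open>\<sigma>\<^sub>0\<close> before \<open>b\<close>. This is the shelling of the ball of windows, relative to its last ridge,
  times the shelling of the boundary of the simplex \<open>\<sigma>\<^sub>0\<close>.\<close>

lemma P_window_faces_decomposable:
  assumes k: "-1 \<le> k" "k < m"
  shows "interval_decomposable (\<lambda>_. m)
    {\<rho> \<in> P_complex m k. \<not> P_face m k \<subseteq> \<rho> \<and> \<not> \<rho> \<subseteq> P_D2 m k}"
proof -
  let ?s = "P_face m k"
  define lo where "lo = (\<lambda>(a, b). insert (a + 1) {c \<in> ?s. c < b})"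
  define hi where "hi = (\<lambda>(a, b). {a + 1..a + m - k + 1} \<union> (?s - {b}))"
  define S where "S = {0..m - k - 1} \<times> ?s"
  have mem: "\<rho> \<in> {lo (a, b)..hi (a, b)} \<longleftrightarrow> a + 1 \<in> \<rho> \<and> {c \<in> ?s. c < b} \<subseteq> \<rho> \<and>
      \<rho> \<subseteq> {a + 1..a + m - k + 1} \<union> (?s - {b})" for \<rho> a b
    by (auto simp: lo_def hi_def)
  have low: "v \<notin> ?s" if "v \<le> 2*m - 2*k" for v using that by (auto simp: P_face_def)
  have "{\<rho> \<in> P_complex m k. \<not> ?s \<subseteq> \<rho> \<and> \<not> \<rho> \<subseteq> P_D2 m k} = (\<Union>ab\<in>S. {lo ab..hi ab})"
  proof (intro equalityI subsetI)
    fix \<rho> assume "\<rho> \<in> (\<Union>ab\<in>S. {lo ab..hi ab})"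
    then obtain a b where ab: "0 \<le> a" "a \<le> m - k - 1" "b \<in> ?s" "\<rho> \<in> {lo (a, b)..hi (a, b)}"
      by (auto simp: S_def)
    then have "hi (a, b) \<in> P_facets m k" by (auto simp: P_facets_def hi_def)
    then have "\<rho> \<in> P_complex m k" using ab(4) by (auto simp: P_complex_def)
    moreover have "b \<notin> \<rho>" using ab(2,3) ab(4)[unfolded mem] by (auto simp: P_face_def)
    moreover have "a + 1 \<in> \<rho>" using ab(4)[unfolded mem] by simp
    moreover have "a + 1 \<notin> P_D2 m k" using ab(2) k by (auto simp: P_D2_def P_face_def)
    ultimately show "\<rho> \<in> {\<rho> \<in> P_complex m k. \<not> ?s \<subseteq> \<rho> \<and> \<not> \<rho> \<subseteq> P_D2 m k}"
      using ab(3) by auto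
  next
    fix \<rho> assume "\<rho> \<in> {\<rho> \<in> P_complex m k. \<not> ?s \<subseteq> \<rho> \<and> \<not> \<rho> \<subseteq> P_D2 m k}"
    then have \<rho>: "\<rho> \<in> P_complex m k" "\<not> ?s \<subseteq> \<rho>" "\<not> \<rho> \<subseteq> P_D2 m k" by auto
    obtain F where F: "F \<in> P_facets m k" "\<rho> \<subseteq> F" using \<rho>(1) by (auto simp: P_complex_def)
    have V: "\<rho> \<subseteq> {1..2*m - k + 1}"
      using P_facets_subset_vertices[OF _ _ F(1)] k F(2) by (auto simp: P_vertices_def)
    have fin: "finite \<rho>" using V finite_subset by blast
    define b where "b = Min (?s - \<rho>)"
    have b: "b \<in> ?s" "b \<notin> \<rho>" "\<And>c. c \<in> ?s \<Longrightarrow> c < b \<Longrightarrow> c \<in> \<rho>"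
    proof -
      have ne: "finite (?s - \<rho>)" "?s - \<rho> \<noteq> {}" using \<rho>(2) by (auto simp: P_face_def)
      have le: "b \<le> c" if "c \<in> ?s - \<rho>" for c
        unfolding b_def by (rule Min_le[OF ne(1) that])
      have "b \<in> ?s - \<rho>" unfolding b_def by (rule Min_in[OF ne])
      then show "b \<in> ?s" "b \<notin> \<rho>" by auto
      show "c \<in> \<rho>" if "c \<in> ?s" "c < b" for c using le[of c] that by (meson DiffI leD)
    qed
    obtain x where x: "x \<in> \<rho>" "x \<notin> P_D2 m k" using \<rho>(3) by blast
    then have xl: "x \<le> m - k" using V by (force simp: P_D2_def P_face_def)
    define a where "a = Min \<rho> - 1"
    have "Min \<rho> \<in> \<rho>" "Min \<rho> \<le> x" "\<And>v. v \<in> \<rho> \<Longrightarrow> Min \<rho> \<le> v" using fin x(1) by (auto intro: Min_in)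
    then have a: "a + 1 \<in> \<rho>" "0 \<le> a" "a \<le> m - k - 1" "\<And>v. v \<in> \<rho> \<Longrightarrow> a + 1 \<le> v"
      using xl V by (auto simp: a_def)
    have up: "v \<le> a + m - k + 1" if v: "v \<in> \<rho>" "v \<notin> ?s" for v
    proof -
      consider "F = P_D1 m k" | "F = P_D2 m k"
        | a' b' where "F = {a' + 1..a' + m - k + 1} \<union> (P_face m k - {b'})"
        using F(1) unfolding P_facets_def by blast
      then show ?thesis
      proof cases
        case 1
        then show ?thesis using F(2) v a(2) by (auto simp: P_D1_def)
      next
        case 2
        then show ?thesis using F(2) \<rho>(3) by auto
      next
        case 3
        have "a' + 1 \<le> a + 1" using 3 F(2) a(1,3) low[of "a + 1"] k by auto
        moreover have "v \<le> a' + m - k + 1" using 3 F(2) v by auto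
        ultimately show ?thesis by simp
      qed
    qed
    have "\<rho> \<subseteq> {a + 1..a + m - k + 1} \<union> (?s - {b})"
    proof
      fix v assume v: "v \<in> \<rho>"
      show "v \<in> {a + 1..a + m - k + 1} \<union> (?s - {b})"
        using v up[OF v] a(4)[OF v] b(2) by (cases "v \<in> ?s") auto
    qed
    then have "\<rho> \<in> {lo (a, b)..hi (a, b)}" using a(1) b(3) unfolding mem by blast
    moreover have "(a, b) \<in> S" using a(2,3) b(1) by (simp add: S_def)
    ultimately show "\<rho> \<in> (\<Union>ab\<in>S. {lo ab..hi ab})" by blast
  qed
  moreover have "interval_decomposable (\<lambda>_. m) (\<Union>ab\<in>S. {lo ab..hi ab})"
  proof (rule interval_decomposable_UN)
    fix ab assume ab: "ab \<in> S"
    obtain a b where "ab = (a, b)" "0 \<le> a" "a \<le> m - k - 1" "b \<in> ?s"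
      using ab unfolding S_def by auto
    then have hi: "hi ab \<in> P_facets m k" 
      unfolding P_facets_def hi_def by simp blast
    show "interval_decomposable (\<lambda>_. m) {lo ab..hi ab}"
    proof (rule interval_decomposable_interval)
      show "finite (hi ab)" by (cases ab) (simp add: hi_def P_face_def)
      show "lo ab \<subseteq> hi ab" using k by (cases ab) (auto simp: lo_def hi_def)
      show "face_dim (hi ab) = m" using face_dim_P_facet[OF _ _ hi] k by simp
    qed
  next
    fix ab ab' assume S: "ab \<in> S" "ab' \<in> S" "ab \<noteq> ab'"
    show "{lo ab..hi ab} \<inter> {lo ab'..hi ab'} = {}"
    proof (rule ccontr)
      assume "\<not> ?thesis"
      then obtain \<rho> where \<rho>: "\<rho> \<in> {lo ab..hi ab}" "\<rho> \<in> {lo ab'..hi ab'}" by blast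
      obtain a b a' b' where ab: "ab = (a, b)" "ab' = (a', b')" by (meson surj_pair)
      have *: "a \<le> m - k - 1" "a' \<le> m - k - 1" "b \<in> ?s" "b' \<in> ?s"
        using S by (auto simp: S_def ab)
      have r: "a + 1 \<in> \<rho>" "{c \<in> ?s. c < b} \<subseteq> \<rho>" "\<rho> \<subseteq> {a + 1..a + m - k + 1} \<union> (?s - {b})"
        "a' + 1 \<in> \<rho>" "{c \<in> ?s. c < b'} \<subseteq> \<rho>" "\<rho> \<subseteq> {a' + 1..a' + m - k + 1} \<union> (?s - {b'})"
        using \<rho> unfolding ab mem by blast+
      have "a + 1 \<notin> ?s" "a' + 1 \<notin> ?s" using * k by (auto intro!: low)
      then have "a' + 1 \<in> {a + 1..a + m - k + 1}" "a + 1 \<in> {a' + 1..a' + m - k + 1}"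
        using r(1,3,4,6) by blast+
      then have "a = a'" by simp
      have nb: "b \<notin> \<rho>" "b' \<notin> \<rho>" using r(3,6) * by (auto simp: P_face_def)
      then have "\<not> b < b'" "\<not> b' < b" using r(2,5) *(3,4) by auto
      then show False using \<open>a = a'\<close> S(3) ab by simp
    qed
  qed
  ultimately show ?thesis by simp
qed

section \<open>Attachments and the complexes E(m,k)\<close>

text \<open>The faces of an attached complex that are new are those outside \<open>Pow (F i)\<close>: each of them has a
  vertex that does not belong to the base complex.\<close>

lemma attaching_faces_beyond:
  assumes att: "attaching B I F K G" and i: "i \<in> I" and \<rho>: "\<rho> \<in> K i"
  shows "\<rho> \<subseteq> \<Union>B \<longleftrightarrow> \<rho> \<subseteq> F i"
proof -
  have "\<Union>(K i) \<inter> \<Union>B = F i" using att i by (simp add: attaching_def)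
  moreover have "\<rho> \<subseteq> \<Union>(K i)" using \<rho> by (rule Union_upper)
  ultimately show ?thesis by (metis Int_subset_iff)
qed

lemma attaching_new_outside:
  assumes att: "attaching B I F K G" and \<rho>: "\<rho> \<in> (\<Union>i\<in>I. K i - Pow (F i))"
  shows "\<not> \<rho> \<subseteq> \<Union>B"
proof -
  obtain i where i: "i \<in> I" "\<rho> \<in> K i" "\<not> \<rho> \<subseteq> F i" using \<rho> by blast
  then show ?thesis using attaching_faces_beyond[OF att i(1,2)] by simp
qed

lemma attaching_new_disjoint:
  assumes att: "attaching B I F K G" and ij: "i \<in> I" "j \<in> I" "i \<noteq> j"
  shows "(K i - Pow (F i)) \<inter> (K j - Pow (F j)) = {}"
proof -
  have "\<rho> \<subseteq> F i" if "\<rho> \<in> K i" "\<rho> \<in> K j" for \<rho>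
  proof -
    have "\<Union>(K i) \<inter> \<Union>(K j) \<subseteq> \<Union>B" using ij att by (simp add: attaching_def)
    moreover have "\<rho> \<subseteq> \<Union>(K i)" "\<rho> \<subseteq> \<Union>(K j)" using that by (simp_all add: Union_upper)
    ultimately have "\<rho> \<subseteq> \<Union>B" by (meson Int_greatest order_trans)
    then show ?thesis using attaching_faces_beyond[OF att ij(1) that(1)] by simp
  qed
  then show ?thesis by blast
qed

lemma attaching_split:
  assumes att: "attaching B I F K G" and sub: "\<And>i. i \<in> I \<Longrightarrow> Pow (F i) \<subseteq> B"
  shows "G = B \<union> (\<Union>i\<in>I. K i - Pow (F i))" and "B \<inter> (\<Union>i\<in>I. K i - Pow (F i)) = {}"
proof -
  let ?N = "\<Union>i\<in>I. K i - Pow (F i)"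
  have G: "G = B \<union> (\<Union>i\<in>I. K i)" using att by (simp add: attaching_def)
  show "G = B \<union> ?N"
  proof (intro equalityI subsetI)
    fix \<rho> assume "\<rho> \<in> G"
    then consider "\<rho> \<in> B" | i where "i \<in> I" "\<rho> \<in> K i" unfolding G by blast
    then show "\<rho> \<in> B \<union> ?N"
    proof cases
      case 2
      then show ?thesis using sub[OF 2(1)] by (cases "\<rho> \<subseteq> F i") auto
    qed simp
  qed (auto simp: G)
  have "\<rho> \<notin> B" if "\<rho> \<in> ?N" for \<rho>
    using attaching_new_outside[OF att that] Union_upper[of \<rho> B] by blast
  then show "B \<inter> ?N = {}" by blast
qed

lemma attaching_minus_face:
  assumes att: "attaching B I F K G" and sub: "\<And>i. i \<in> I \<Longrightarrow> Pow (F i) \<subseteq> B" and D: "D \<in> B"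
  shows "G - Pow D = (B - Pow D) \<union> (\<Union>i\<in>I. K i - Pow (F i))" (is "_ = _ \<union> ?N")
proof -
  have "\<not> \<rho> \<subseteq> D" if "\<rho> \<in> ?N" for \<rho>
    using attaching_new_outside[OF att that] Union_upper[OF D] by blast
  then have "?N - Pow D = ?N" by blast
  then show ?thesis using attaching_split(1)[OF att sub] by (simp only: Un_Diff)
qed

text \<open>The inductive invariant of a copy \<open>K\<close> of \<open>E(m,k)\<close> with specified facet \<open>D\<close> and specified
  face \<open>\<sigma>\<close>. Attaching \<open>K\<close> along \<open>D\<close> adds exactly the faces in \<open>K - Pow D\<close>, and these can be
  decomposed both by themselves and together with \<open>\<sigma>\<close>. So the attachment acts as a switch: it
  leaves open whether \<open>\<sigma>\<close> has to be covered elsewhere.\<close>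

definition partition_gadget :: "int \<Rightarrow> 'a set set \<Rightarrow> 'a set \<Rightarrow> 'a set \<Rightarrow> bool" where
  "partition_gadget m K D \<sigma> \<longleftrightarrow>
     finite K \<and> (\<forall>\<rho>\<in>K. finite \<rho> \<and> face_dim \<rho> \<le> m) \<and> (\<forall>\<rho>\<in>K. Pow \<rho> \<subseteq> K) \<and>
     interval_decomposable (\<lambda>_. m) (K - Pow D) \<and>
     interval_decomposable (\<lambda>_. m) (insert \<sigma> (K - Pow D))"

text \<open>Let \<open>A\<close> be the set of faces treated in \<open>P_window_faces_decomposable\<close>. By
  \<open>P_complex_above_face\<close>, the faces of \<open>P(m,k)\<close> outside \<open>Pow D\<^sub>2\<close> are those in \<open>A\<close> and the
  faces \<open>\<tau>\<close> with \<open>\<sigma>\<^sub>0 \<subset> \<tau> \<subseteq> D\<^sub>1\<close>, and \<open>E(m,k)\<close> has one gadget attached for each such \<open>\<tau>\<close>.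
  If \<open>\<sigma>\<^sub>0\<close> is to be left out, each gadget is decomposed together with its \<open>\<tau>\<close>. If \<open>\<sigma>\<^sub>0\<close> is to be
  covered, the interval \<open>{\<sigma>\<^sub>0..D\<^sub>1}\<close> covers \<open>\<sigma>\<^sub>0\<close> and all of the \<open>\<tau>\<close> at once, and each gadget is
  decomposed without its \<open>\<tau>\<close>.\<close>

lemma E_copy_partition_gadget: "E_copy m k K D \<sigma> \<Longrightarrow> partition_gadget m K D \<sigma>"
proof (induction rule: E_copy.induct)
  case (E_base m g)
  let ?V = "P_face m m"
  have V: "P_vertices m m = ?V" "P_D1 m m = ?V" "P_D2 m m = ?V"
    by (simp_all add: P_vertices_def P_D1_def P_D2_def P_face_def)
  have "P_facets m m = {?V}" unfolding P_facets_def V by auto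
  then have P: "P_complex m m = Pow ?V" by (auto simp: P_complex_def)
  have img: "(`) g ` Pow ?V = Pow (g ` ?V)" by (simp add: image_Pow_surj)
  have fin: "finite (g ` ?V)" by (simp add: P_face_def)
  have dim: "face_dim (g ` ?V) = m"
    using E_base card_image[of g ?V] by (simp add: V face_dim_def P_face_def)
  have "face_dim \<rho> \<le> m" if "\<rho> \<subseteq> g ` ?V" for \<rho>
    using card_mono[OF fin that] dim by (simp add: face_dim_def)
  moreover have "interval_decomposable (\<lambda>_. m) {g ` ?V}"
    using interval_decomposable_interval[OF fin subset_refl, of "\<lambda>_. m"] dim by simp
  ultimately show ?case
    unfolding partition_gadget_def P V img using fin dim
    by (auto simp: interval_decomposable_empty intro: finite_subset)
next
  case (E_step k m g K G)
  let ?s = "P_face m k" and ?D1 = "P_D1 m k" and ?D2 = "P_D2 m k"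
  let ?B = "(`) g ` P_complex m k"
  let ?I = "{\<tau>. g ` ?s \<subset> \<tau> \<and> \<tau> \<subseteq> g ` ?D1}"
  let ?new = "\<lambda>\<tau>. K \<tau> - Pow (g ` ?D1)"
  note att = E_step.hyps(5)
  have inj: "inj_on g (P_vertices m k)" by fact
  have k: "-1 \<le> k" "k \<le> m" "k < m" using E_step.hyps by auto
  have IH: "partition_gadget m (K \<tau>) (g ` ?D1) \<tau>" if "\<tau> \<in> ?I" for \<tau>
    using E_step that by blast
  have G: "G = ?B \<union> (\<Union>\<tau>\<in>?I. K \<tau>)" using att by (simp add: attaching_def)
  have facets: "?D1 \<in> P_facets m k" "?D2 \<in> P_facets m k" by (auto simp: P_facets_def)
  have PV: "\<rho> \<subseteq> P_vertices m k" if "\<rho> \<in> P_complex m k" for \<rho>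
    using that P_complex_vertices[OF k(1,2)] by blast
  have finV: "finite (P_vertices m k)" by (simp add: P_vertices_def)
  have PD: "?D1 \<in> P_complex m k" "?D2 \<in> P_complex m k" using facets by (auto simp: P_complex_def)
  have facedim_img: "face_dim (g ` \<rho>) = face_dim \<rho>" if "\<rho> \<subseteq> P_vertices m k" for \<rho>
    using card_image[OF inj_on_subset[OF inj that]] by (simp add: face_dim_def)
  have sub_img: "g ` \<alpha> \<subseteq> g ` \<beta> \<longleftrightarrow> \<alpha> \<subseteq> \<beta>"
    if "\<alpha> \<subseteq> P_vertices m k" "\<beta> \<subseteq> P_vertices m k" for \<alpha> \<beta>
    using that inj_on_image_mem_iff[OF inj _ that(2)] by blast
  have sV: "?s \<subseteq> P_vertices m k" "?s \<subseteq> ?D1" "?s \<subseteq> ?D2" using PV[OF PD(2)] by (auto simp: P_D1_def P_D2_def)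
  define W where "W = {\<rho> \<in> P_complex m k. \<not> ?s \<subseteq> \<rho> \<and> \<not> \<rho> \<subseteq> ?D2}"
  have B_minus: "?B - Pow (g ` ?D2) = (`) g ` W \<union> ?I"
  proof (intro equalityI subsetI)
    fix \<rho> assume "\<rho> \<in> ?B - Pow (g ` ?D2)"
    then obtain \<alpha> where \<alpha>: "\<alpha> \<in> P_complex m k" "\<rho> = g ` \<alpha>" "\<not> \<alpha> \<subseteq> ?D2" by auto
    show "\<rho> \<in> (`) g ` W \<union> ?I"
    proof (cases "?s \<subseteq> \<alpha>")
      case True
      then have "\<alpha> \<subseteq> ?D1" "\<not> \<alpha> \<subseteq> ?s"
        using P_complex_above_face[OF k(1,3) \<alpha>(1)] \<alpha>(3) sV(3) by auto
      then have "\<rho> \<in> ?I" using True sub_img[OF PV[OF \<alpha>(1)] sV(1)] \<alpha>(2) by auto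
      then show ?thesis ..
    next
      case False
      then show ?thesis using \<alpha> by (auto simp: W_def)
    qed
  next
    fix \<rho> assume "\<rho> \<in> (`) g ` W \<union> ?I"
    then show "\<rho> \<in> ?B - Pow (g ` ?D2)"
    proof
      assume "\<rho> \<in> (`) g ` W"
      then obtain \<alpha> where \<alpha>: "\<alpha> \<in> W" "\<rho> = g ` \<alpha>" by auto
      then have "\<alpha> \<in> P_complex m k" "\<not> \<alpha> \<subseteq> ?D2" by (auto simp: W_def)
      then show ?thesis using sub_img[OF PV PV[OF PD(2)], of \<alpha>] \<alpha>(2) by auto
    next
      assume \<rho>: "\<rho> \<in> ?I"
      then have "\<rho> \<subseteq> g ` ?D1" by simp
      then obtain \<alpha> where \<alpha>: "\<alpha> \<subseteq> ?D1" "\<rho> = g ` \<alpha>" by (rule subset_imageE)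
      have a: "\<alpha> \<in> P_complex m k" using P_complex_subset_face[OF PD(1) \<alpha>(1)] .
      have "\<not> \<alpha> \<subseteq> ?s" using \<rho> \<alpha>(2) by auto
      then have "\<not> \<alpha> \<subseteq> ?D2" using \<alpha>(1) P_D1_inter_P_D2[of m k] by blast
      then show ?thesis using sub_img[OF PV[OF a] PV[OF PD(2)]] \<alpha>(2) a by auto
    qed
  qed
  have in_B: "\<rho> \<in> ?B" if "\<rho> \<subseteq> g ` ?D1" for \<rho>
    using that P_complex_subset_face[OF PD(1)] by (auto elim!: subset_imageE)
  then have D1B: "Pow (g ` ?D1) \<subseteq> ?B" by (meson PowD subsetI)
  have D2B: "g ` ?D2 \<in> ?B" using PD(2) by blast
  define N where "N = (\<Union>\<tau>\<in>?I. ?new \<tau>)"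
  have BN: "A \<inter> N = {}" if "A \<subseteq> ?B" for A
    using attaching_split(2)[OF att D1B, folded N_def] that by (meson disjoint_iff subsetD)
  have G_minus: "G - Pow (g ` ?D2) = (`) g ` W \<union> ?I \<union> N"
    using attaching_minus_face[OF att D1B D2B, folded N_def] unfolding B_minus .
  have W_dec: "interval_decomposable (\<lambda>_. m) ((`) g ` W)"
    by (rule interval_decomposable_image[OF _ inj])
      (use P_window_faces_decomposable[OF k(1,3)] PV in \<open>auto simp: W_def\<close>)
  have W_s: "\<not> g ` ?s \<subseteq> \<rho>" if "\<rho> \<in> (`) g ` W" for \<rho>
    using that sub_img[OF sV(1) PV] by (auto simp: W_def)
  have WB: "(`) g ` W \<subseteq> ?B" by (auto simp: W_def)
  have disj: "?new \<tau> \<inter> ?new \<tau>' = {}" if "\<tau> \<in> ?I" "\<tau>' \<in> ?I" "\<tau> \<noteq> \<tau>'" for \<tau> \<tau>'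
    by (rule attaching_new_disjoint[OF att that])
  have new_dec: "interval_decomposable (\<lambda>_. m) N"
    unfolding N_def
  proof (rule interval_decomposable_UN[OF _ disj])
    show "interval_decomposable (\<lambda>_. m) (?new \<tau>)" if "\<tau> \<in> ?I" for \<tau>
      using IH[OF that] unfolding partition_gadget_def by blast
  qed
  have I_new: "(\<Union>\<tau>\<in>?I. insert \<tau> (?new \<tau>)) = ?I \<union> N" unfolding N_def by blast
  have I_new_dec: "interval_decomposable (\<lambda>_. m) (?I \<union> N)"
    unfolding I_new[symmetric]
  proof (rule interval_decomposable_UN)
    fix \<tau> assume "\<tau> \<in> ?I"
    from IH[OF this] show "interval_decomposable (\<lambda>_. m) (insert \<tau> (?new \<tau>))"
      unfolding partition_gadget_def by blast
  next
    fix \<tau> \<tau>' assume t: "\<tau> \<in> ?I" "\<tau>' \<in> ?I" "\<tau> \<noteq> \<tau>'"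
    then have "\<tau> \<subseteq> g ` ?D1" "\<tau>' \<subseteq> g ` ?D1" by auto
    then show "insert \<tau> (?new \<tau>) \<inter> insert \<tau>' (?new \<tau>') = {}"
      using disj[OF t] t(3) by blast
  qed
  have D1_dec: "interval_decomposable (\<lambda>_. m) {g ` ?s..g ` ?D1}"
  proof (rule interval_decomposable_interval)
    show "finite (g ` ?D1)" using finite_subset[OF PV[OF PD(1)] finV] by simp
    show "g ` ?s \<subseteq> g ` ?D1" using sV(2) by (rule image_mono)
    show "face_dim (g ` ?D1) = m"
      using facedim_img[OF PV[OF PD(1)]] face_dim_P_facet[OF k(1,2) facets(1)] by simp
  qed
  have dec1: "interval_decomposable (\<lambda>_. m) (G - Pow (g ` ?D2))"
  proof -
    have "(`) g ` W \<inter> ?I = {}" using W_s by auto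
    then have "(`) g ` W \<inter> (?I \<union> N) = {}" using BN[OF WB] by (simp only: Int_Un_distrib Un_empty)
    from interval_decomposable_Un[OF W_dec I_new_dec this]
    show ?thesis unfolding G_minus Un_assoc .
  qed
  have dec2: "interval_decomposable (\<lambda>_. m) (insert (g ` ?s) (G - Pow (g ` ?D2)))"
  proof -
    have "{a..b} = insert a {\<tau>. a \<subset> \<tau> \<and> \<tau> \<subseteq> b}" if "a \<subseteq> b" for a b :: "'a set"
      using that by auto
    from this[OF image_mono[OF sV(2)]]
    have Ieq: "{g ` ?s..g ` ?D1} = insert (g ` ?s) ?I" .
    have 1: "(`) g ` W \<inter> {g ` ?s..g ` ?D1} = {}" using W_s by auto
    have "{g ` ?s..g ` ?D1} \<subseteq> ?B" using in_B by (meson atLeastAtMost_iff subsetI)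
    with WB have "(`) g ` W \<union> {g ` ?s..g ` ?D1} \<subseteq> ?B" by (rule Un_least)
    from interval_decomposable_Un[OF interval_decomposable_Un[OF W_dec D1_dec 1] new_dec BN[OF this]]
    show ?thesis unfolding G_minus Ieq by (simp only: Un_insert_left Un_insert_right)
  qed
  have finI: "finite ?I"
    by (rule finite_subset[of _ "Pow (g ` ?D1)"]) (auto simp: P_D1_def P_face_def)
  have finB: "finite ?B"
    by (rule finite_imageI, rule finite_subset[of _ "Pow (P_vertices m k)"]) (use PV finV in auto)
  have "finite (K \<tau>)" if "\<tau> \<in> ?I" for \<tau> using IH[OF that] unfolding partition_gadget_def by blast
  then have finG: "finite G" unfolding G using finB finI by simp
  have faces: "finite \<rho> \<and> face_dim \<rho> \<le> m \<and> Pow \<rho> \<subseteq> G" if \<rho>: "\<rho> \<in> G" for \<rho>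
  proof (cases "\<rho> \<in> ?B")
    case True
    then obtain \<alpha> F where \<alpha>: "\<alpha> \<in> P_complex m k" "\<rho> = g ` \<alpha>" "F \<in> P_facets m k" "\<alpha> \<subseteq> F"
      by (auto simp: P_complex_def)
    have "finite F" using finite_subset[OF P_facets_subset_vertices[OF k(1,2) \<alpha>(3)] finV] .
    then have fin: "finite \<alpha>" "face_dim \<alpha> \<le> m"
      using card_mono[OF _ \<alpha>(4)] face_dim_P_facet[OF k(1,2) \<alpha>(3)] finite_subset[OF \<alpha>(4)]
      by (simp_all add: face_dim_def)
    have "Pow \<rho> \<subseteq> ?B"
    proof
      fix \<beta> assume "\<beta> \<in> Pow \<rho>"
      then have "\<beta> \<subseteq> g ` \<alpha>" using \<alpha>(2) by simp
      then obtain \<gamma> where "\<gamma> \<subseteq> \<alpha>" "\<beta> = g ` \<gamma>" by (rule subset_imageE)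
      then show "\<beta> \<in> ?B" using P_complex_subset_face[OF \<alpha>(1)] by blast
    qed
    then have "Pow \<rho> \<subseteq> G" unfolding G by (rule le_supI1)
    then show ?thesis using facedim_img[OF PV[OF \<alpha>(1)]] fin \<alpha>(2) by simp
  next
    case False
    then obtain \<tau> where \<tau>: "\<tau> \<in> ?I" "\<rho> \<in> K \<tau>" using \<rho> unfolding G by blast
    then have "finite \<rho>" "face_dim \<rho> \<le> m" "Pow \<rho> \<subseteq> K \<tau>"
      using IH[OF \<tau>(1)] unfolding partition_gadget_def by blast+
    moreover have "K \<tau> \<subseteq> G" unfolding G using \<tau>(1) by blast
    ultimately show ?thesis by (meson order_trans)
  qed
  show ?case unfolding partition_gadget_def
  proof (intro conjI ballI finG dec1 dec2)
    show "finite \<rho>" "face_dim \<rho> \<le> m" "Pow \<rho> \<subseteq> G" if "\<rho> \<in> G" for \<rho>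
      using faces[OF that] by simp_all
  qed
qed

section \<open>The partition extender\<close>

lemma f_triangle_disjoint_Un:
  assumes fin: "finite X" and X: "X = A \<union> B" "A \<inter> B = {}"
    and dA: "\<And>\<rho>. \<rho> \<in> A \<Longrightarrow> degree_dim X \<rho> = degree_dim A \<rho>"
    and dB: "\<And>\<rho>. \<rho> \<in> B \<Longrightarrow> degree_dim X \<rho> = degree_dim B \<rho>"
  shows "f_triangle X i j = f_triangle A i j + f_triangle B i j"
proof -
  let ?f = "\<lambda>Y. {\<sigma> \<in> Y. degree_dim Y \<sigma> = int i - 1 \<and> face_dim \<sigma> = int j - 1}"
  have "?f X = ?f A \<union> ?f B" using X(1) dA dB by auto
  moreover have "card (?f A \<union> ?f B) = card (?f A) + card (?f B)"
    by (rule card_Un_disjoint) (use fin X in auto)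
  ultimately show ?thesis by (simp add: f_triangle_def)
qed

lemma h_triangle_add:
  assumes "\<And>k. f_triangle X i k = f_triangle A i k + f_triangle B i k"
  shows "h_triangle X i j = h_triangle A i j + h_triangle B i j"
  unfolding h_triangle_def assms by (simp add: ring_distribs sum.distrib)

text \<open>\<open>\<Gamma>\<close> is the disjoint union of \<open>\<Delta>\<close> and the sets of new faces of the gadgets, one for each face of
  \<open>\<Delta>\<close>. A decomposition of \<open>\<Gamma>\<close> comes from decomposing each gadget together with its face \<open>\<sigma>\<close>, one
  of the relative complex from decomposing each gadget without it. A gadget at \<open>\<sigma>\<close> has top
  elements of dimension \<open>degree_dim \<Delta> \<sigma>\<close>. For compatibility with the \<open>h\<close>-triangle this has to be
  the largest dimension of a face of \<open>\<Gamma>\<close> above the bottom elements: a face above a new face lies in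
  the same gadget, and a gadget at \<open>\<sigma>'\<close> adds above an old face nothing larger than \<open>F \<sigma>'\<close>,
  which contains that face. The second observation shows moreover that old faces keep their
  degree, whence the triangles of \<open>\<Delta>\<close> and of the relative complex add up to those of \<open>\<Gamma>\<close>.\<close>

theorem partition_extender_h_compatible:
  fixes \<Delta> \<Gamma> :: "'a set set"
  assumes cplx: "simplicial_complex \<Delta>" and ext: "partition_extender \<Delta> \<Gamma>"
  shows "\<exists>\<P>. h_compatible_partitioning \<Gamma> \<P>"
    and "\<exists>\<Q>. h_compatible_partitioning (relative_complex \<Gamma> \<Delta>) \<Q>"
    and "h_triangle \<Gamma> i j = h_triangle \<Delta> i j + h_triangle (relative_complex \<Gamma> \<Delta>) i j"
proof -
  obtain F K where FK: "\<And>\<sigma>. \<sigma> \<in> \<Delta> \<Longrightarrow> facet \<Delta> (F \<sigma>)"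
      "\<And>\<sigma>. \<sigma> \<in> \<Delta> \<Longrightarrow> face_dim (F \<sigma>) = degree_dim \<Delta> \<sigma>"
      "\<And>\<sigma>. \<sigma> \<in> \<Delta> \<Longrightarrow> \<sigma> \<subseteq> F \<sigma>"
      "\<And>\<sigma>. \<sigma> \<in> \<Delta> \<Longrightarrow> E_copy (degree_dim \<Delta> \<sigma>) (face_dim \<sigma>) (K \<sigma>) (F \<sigma>) \<sigma>"
    and att: "attaching \<Delta> \<Delta> F K \<Gamma>"
    using ext unfolding partition_extender_def by blast
  have E: "partition_gadget (degree_dim \<Delta> \<sigma>) (K \<sigma>) (F \<sigma>) \<sigma>" if "\<sigma> \<in> \<Delta>" for \<sigma>
    using E_copy_partition_gadget[OF FK(4)[OF that]] .
  have Kfin: "finite (K \<sigma>)" and Kface: "\<And>\<rho>. \<rho> \<in> K \<sigma> \<Longrightarrow> finite \<rho>"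
      "\<And>\<rho>. \<rho> \<in> K \<sigma> \<Longrightarrow> face_dim \<rho> \<le> degree_dim \<Delta> \<sigma>"
      "\<And>\<rho> \<alpha>. \<rho> \<in> K \<sigma> \<Longrightarrow> \<alpha> \<subseteq> \<rho> \<Longrightarrow> \<alpha> \<in> K \<sigma>"
    and Kdec: "interval_decomposable (\<lambda>_. degree_dim \<Delta> \<sigma>) (K \<sigma> - Pow (F \<sigma>))"
      "interval_decomposable (\<lambda>_. degree_dim \<Delta> \<sigma>) (insert \<sigma> (K \<sigma> - Pow (F \<sigma>)))"
    if "\<sigma> \<in> \<Delta>" for \<sigma>
    using E[OF that] unfolding partition_gadget_def by blast+
  have down: "\<alpha> \<in> \<Delta>" if "\<rho> \<in> \<Delta>" "\<alpha> \<subseteq> \<rho>" for \<rho> \<alpha>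
    using cplx that by (auto simp: simplicial_complex_def)
  have fin_vert: "finite (\<Union>\<Delta>)" using cplx by (simp add: simplicial_complex_def)
  have fin\<Delta>: "finite \<Delta>" using fin_vert by (rule finite_UnionD)
  have fin\<Delta>face: "finite \<rho>" if "\<rho> \<in> \<Delta>" for \<rho>
    using finite_subset[OF Union_upper[OF that] fin_vert] .
  have F\<Delta>: "F \<sigma> \<in> \<Delta>" if "\<sigma> \<in> \<Delta>" for \<sigma> using FK(1)[OF that] by (simp add: facet_def)
  define new where "new \<sigma> = K \<sigma> - Pow (F \<sigma>)" for \<sigma>
  define R where "R = relative_complex \<Gamma> \<Delta>"
  have newK: "\<rho> \<in> K \<sigma>" if "\<rho> \<in> new \<sigma>" for \<rho> \<sigma> using that by (simp add: new_def)
  have new_outside: "\<rho> \<notin> \<Delta>" if "\<sigma> \<in> \<Delta>" "\<rho> \<in> new \<sigma>" for \<sigma> \<rho>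
    using attaching_faces_beyond[OF att that(1) newK[OF that(2)]] that(2) by (auto simp: new_def)
  have \<Gamma>: "\<Gamma> = \<Delta> \<union> (\<Union>\<sigma>\<in>\<Delta>. K \<sigma>)" using att by (simp add: attaching_def)
  have F_sub: "Pow (F \<sigma>) \<subseteq> \<Delta>" if "\<sigma> \<in> \<Delta>" for \<sigma> using down[OF F\<Delta>[OF that]] by blast
  have split: "\<Gamma> = \<Delta> \<union> (\<Union>\<sigma>\<in>\<Delta>. new \<sigma>)" "\<Delta> \<inter> (\<Union>\<sigma>\<in>\<Delta>. new \<sigma>) = {}"
    unfolding new_def by (rule attaching_split[OF att F_sub], assumption)+
  have R: "R = (\<Union>\<sigma>\<in>\<Delta>. new \<sigma>)"
  proof -
    have "R = \<Gamma> - \<Delta>" by (auto simp: R_def relative_complex_def)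
    then show ?thesis using split by (metis Diff_cancel Diff_triv Int_commute Un_Diff Un_empty_left)
  qed
  have new_disj: "new \<sigma> \<inter> new \<sigma>' = {}" if "\<sigma> \<in> \<Delta>" "\<sigma>' \<in> \<Delta>" "\<sigma> \<noteq> \<sigma>'" for \<sigma> \<sigma>'
    unfolding new_def by (rule attaching_new_disjoint[OF att that])
  have fin\<Gamma>: "finite \<Gamma>" unfolding \<Gamma> using fin\<Delta> Kfin by simp
  have fin\<Gamma>face: "finite \<rho>" if "\<rho> \<in> \<Gamma>" for \<rho> using that fin\<Delta>face Kface(1) unfolding \<Gamma> by auto
  have R\<Gamma>: "R \<subseteq> \<Gamma>" by (auto simp: R_def relative_complex_def)
  have finR: "finite R" using finite_subset[OF R\<Gamma> fin\<Gamma>] .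
  have new_above: "\<tau> \<in> new \<sigma>" if above: "\<sigma> \<in> \<Delta>" "\<rho> \<in> new \<sigma>" "\<tau> \<in> \<Gamma>" "\<rho> \<subseteq> \<tau>" for \<sigma> \<rho> \<tau>
  proof -
    have \<rho>: "\<rho> \<notin> \<Delta>" using new_outside[OF above(1,2)] .
    then have "\<tau> \<notin> \<Delta>" using down above(4) by blast
    then obtain \<sigma>' where \<sigma>': "\<sigma>' \<in> \<Delta>" "\<tau> \<in> new \<sigma>'" using above(3) unfolding split(1) by blast
    have "\<rho> \<in> K \<sigma>'" using Kface(3)[OF \<sigma>'(1) newK[OF \<sigma>'(2)] above(4)] .
    moreover have "\<not> \<rho> \<subseteq> F \<sigma>'" using \<rho> down[OF F\<Delta>[OF \<sigma>'(1)]] by blast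
    ultimately have "\<rho> \<in> new \<sigma>'" by (simp add: new_def)
    then have "\<sigma>' = \<sigma>" using new_disj[OF \<sigma>'(1) above(1)] above(2) by blast
    then show ?thesis using \<sigma>'(2) by simp
  qed
  have deg_new: "degree_dim \<Gamma> \<rho> = degree_dim \<Delta> \<sigma>" "degree_dim R \<rho> = degree_dim \<Delta> \<sigma>"
    if \<sigma>: "\<sigma> \<in> \<Delta>" and \<rho>: "\<rho> \<in> new \<sigma>" for \<sigma> \<rho>
  proof -
    obtain \<tau> where \<tau>: "\<tau> \<in> new \<sigma>" "\<rho> \<subseteq> \<tau>" "face_dim \<tau> = degree_dim \<Delta> \<sigma>"
      using interval_decomposable_obtains_top[OF Kdec(1)[OF \<sigma>, folded new_def] \<rho>] .
    have mem: "\<tau> \<in> \<Gamma>" "\<tau> \<in> R" using \<tau>(1) \<sigma> unfolding split(1) R by auto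
    have bound: "face_dim \<tau>' \<le> degree_dim \<Delta> \<sigma>" if "\<tau>' \<in> \<Gamma>" "\<rho> \<subseteq> \<tau>'" for \<tau>'
      using Kface(2)[OF \<sigma> newK[OF new_above[OF \<sigma> \<rho> that]]] .
    show "degree_dim \<Gamma> \<rho> = degree_dim \<Delta> \<sigma>"
      by (rule degree_dim_eqI[OF fin\<Gamma> mem(1) \<tau>(2,3) bound])
    show "degree_dim R \<rho> = degree_dim \<Delta> \<sigma>"
      by (rule degree_dim_eqI[OF finR mem(2) \<tau>(2,3) bound]) (use R\<Gamma> in auto)
  qed
  have deg_old: "degree_dim \<Gamma> \<sigma> = degree_dim \<Delta> \<sigma>" if \<sigma>: "\<sigma> \<in> \<Delta>" for \<sigma>
  proof (rule degree_dim_eqI[OF fin\<Gamma> _ FK(3,2)[OF \<sigma>]])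
    show "F \<sigma> \<in> \<Gamma>" using F\<Delta>[OF \<sigma>] by (simp add: \<Gamma>)
    fix \<tau> assume \<tau>: "\<tau> \<in> \<Gamma>" "\<sigma> \<subseteq> \<tau>"
    show "face_dim \<tau> \<le> degree_dim \<Delta> \<sigma>"
    proof (cases "\<tau> \<in> \<Delta>")
      case True
      then show ?thesis using face_dim_le_degree_dim[OF fin\<Delta> True \<tau>(2)] by simp
    next
      case False
      then obtain \<sigma>' where \<sigma>': "\<sigma>' \<in> \<Delta>" "\<tau> \<in> K \<sigma>'" using \<tau>(1) unfolding \<Gamma> by blast
      have "\<sigma> \<in> K \<sigma>'" using Kface(3)[OF \<sigma>' \<tau>(2)] .
      then have "\<sigma> \<subseteq> F \<sigma>'"
        using attaching_faces_beyond[OF att \<sigma>'(1)] Union_upper[OF \<sigma>] by simp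
      then have "face_dim (F \<sigma>') \<le> degree_dim \<Delta> \<sigma>"
        using face_dim_le_degree_dim[OF fin\<Delta> F\<Delta>[OF \<sigma>'(1)]] by simp
      then show ?thesis using Kface(2)[OF \<sigma>'] FK(2)[OF \<sigma>'(1)] by simp
    qed
  qed
  show "\<exists>\<P>. h_compatible_partitioning \<Gamma> \<P>"
  proof (rule h_compatible_if_interval_decomposable[OF fin\<Gamma> fin\<Gamma>face])
    have "\<Gamma> = (\<Union>\<sigma>\<in>\<Delta>. insert \<sigma> (new \<sigma>))" unfolding split(1) by blast
    moreover have "interval_decomposable (degree_dim \<Gamma>) (\<Union>\<sigma>\<in>\<Delta>. insert \<sigma> (new \<sigma>))"
    proof (rule interval_decomposable_UN)
      fix \<sigma> assume \<sigma>: "\<sigma> \<in> \<Delta>"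
      show "interval_decomposable (degree_dim \<Gamma>) (insert \<sigma> (new \<sigma>))"
        by (rule interval_decomposable_cong[OF Kdec(2)[OF \<sigma>, folded new_def]])
          (use deg_old deg_new(1) \<sigma> in auto)
    next
      fix \<sigma> \<sigma>' assume s: "\<sigma> \<in> \<Delta>" "\<sigma>' \<in> \<Delta>" "\<sigma> \<noteq> \<sigma>'"
      show "insert \<sigma> (new \<sigma>) \<inter> insert \<sigma>' (new \<sigma>') = {}"
        using new_disj[OF s] new_outside[OF s(1)] new_outside[OF s(2)] s by blast
    qed
    ultimately show "interval_decomposable (degree_dim \<Gamma>) \<Gamma>" by metis
  qed
  have "\<exists>\<Q>. h_compatible_partitioning R \<Q>"
  proof (rule h_compatible_if_interval_decomposable[OF finR])
    show "finite \<rho>" if "\<rho> \<in> R" for \<rho> using that R\<Gamma> fin\<Gamma>face by blast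
    have "interval_decomposable (degree_dim R) (\<Union>\<sigma>\<in>\<Delta>. new \<sigma>)"
    proof (rule interval_decomposable_UN[OF _ new_disj])
      fix \<sigma> assume \<sigma>: "\<sigma> \<in> \<Delta>"
      show "interval_decomposable (degree_dim R) (new \<sigma>)"
        by (rule interval_decomposable_cong[OF Kdec(1)[OF \<sigma>, folded new_def]])
          (use deg_new(2) \<sigma> in auto)
    qed
    then show "interval_decomposable (degree_dim R) R" by (metis R)
  qed
  then show "\<exists>\<Q>. h_compatible_partitioning (relative_complex \<Gamma> \<Delta>) \<Q>" by (simp add: R_def)
  have "h_triangle \<Gamma> i j = h_triangle \<Delta> i j + h_triangle R i j"
  proof (rule h_triangle_add, rule f_triangle_disjoint_Un[OF fin\<Gamma>])
    show "\<Gamma> = \<Delta> \<union> R" unfolding R by (rule split(1))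
    show "\<Delta> \<inter> R = {}" by (auto simp: R_def relative_complex_def)
    show "degree_dim \<Gamma> \<rho> = degree_dim \<Delta> \<rho>" if "\<rho> \<in> \<Delta>" for \<rho> using deg_old[OF that] .
    show "degree_dim \<Gamma> \<rho> = degree_dim R \<rho>" if "\<rho> \<in> R" for \<rho>
    proof -
      obtain \<sigma> where "\<sigma> \<in> \<Delta>" "\<rho> \<in> new \<sigma>" using \<open>\<rho> \<in> R\<close> unfolding R by blast
      then show ?thesis using deg_new by metis
    qed
  qed
  then show "h_triangle \<Gamma> i j = h_triangle \<Delta> i j + h_triangle (relative_complex \<Gamma> \<Delta>) i j"
    by (simp add: R_def)
qed

theorem corollary5p4:
  fixes \<Delta> \<Gamma> :: "'a set set"
  assumes "simplicial_complex \<Delta>"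
    and "\<not> pure_complex \<Delta>"
    and "partition_extender \<Delta> \<Gamma>"
  shows "(\<exists>\<P>. h_compatible_partitioning \<Gamma> \<P>) \<and>
    (\<exists>\<Q>. h_compatible_partitioning (relative_complex \<Gamma> \<Delta>) \<Q>) \<and>
    (\<forall>\<P> \<Q> i j. h_compatible_partitioning \<Gamma> \<P> \<longrightarrow>
       h_compatible_partitioning (relative_complex \<Gamma> \<Delta>) \<Q> \<longrightarrow>
       h_triangle \<Delta> i j =
         int (card {I \<in> \<P>. ij_interval \<Gamma> i j I}) -
         int (card {I \<in> \<Q>. ij_interval (relative_complex \<Gamma> \<Delta>) i j I}))"
proof (intro conjI allI impI)
  fix \<P> \<Q> i j
  assume "h_compatible_partitioning \<Gamma> \<P>"
    and "h_compatible_partitioning (relative_complex \<Gamma> \<Delta>) \<Q>"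
  then have "int (card {I \<in> \<P>. ij_interval \<Gamma> i j I}) = h_triangle \<Gamma> i j"
    and "int (card {I \<in> \<Q>. ij_interval (relative_complex \<Gamma> \<Delta>) i j I}) =
      h_triangle (relative_complex \<Gamma> \<Delta>) i j"
    by (simp_all add: h_compatible_partitioning_def)
  then show "h_triangle \<Delta> i j = int (card {I \<in> \<P>. ij_interval \<Gamma> i j I}) -
      int (card {I \<in> \<Q>. ij_interval (relative_complex \<Gamma> \<Delta>) i j I})"
    using partition_extender_h_compatible(3)[OF assms(1,3), of i j] by linarith
qed (rule partition_extender_h_compatible[OF assms(1,3)])+

end
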